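(* Let $0\le\tau\le1$, fix a time $t$, and let $\theta>0$. Consider the nominal model $x_{t+1}=A_tx_t+B_tv_t$, $y_t=C_tx_t+D_tv_t$ with $x_t\in\mathbb{R}^n$, $y_t\in\mathbb{R}^p$, $v_t\in\mathbb{R}^{n+p}$ white Gaussian noise with identity covariance, and $\Gamma_t=\begin{bmatrix}B_t\\ D_t\end{bmatrix}$ square and invertible. Let $\hat x_t\in\mathbb{R}^n$, let $V_t$ be symmetric positive definite, and let $z_t=[x_{t+1}^T\ y_t^T]^T$ have nominal conditional density given $Y_{t-1}$ $$\bar f_t(z_t|Y_{t-1})\sim\mathcal N\left(\begin{bmatrix}A_t\\ C_t\end{bmatrix}\hat x_t,\ K_{z_t}\right),\qquad K_{z_t}=\begin{bmatrix}A_t\\ C_t\end{bmatrix}V_t\begin{bmatrix}A_t^T&C_t^T\end{bmatrix}+\Gamma_t\Gamma_t^T.$$ Set $$G_t=(A_tV_tC_t^T+B_tD_t^T)(C_tV_tC_t^T+D_tD_t^T)^{-1},$$ $$P_{t+1}=A_tV_tA_t^T-G_t(C_tV_tC_t^T+D_tD_t^T)G_t^T+B_tB_t^T,$$ and let $P_{t+1}=L_{P_{t+1}}L_{P_{t+1}}^T$ with $L_{P_{t+1}}$ square. If $\tau<1$, assume in addition that $P_{t+1}<(\theta(1-\tau))^{-1}I_n$. Consider the $\tau$-risk sensitive problem $$\min_{g_t\in\mathcal G_t}\ \max_{\tilde f_t\in\mathcal B_t}\ \mathbb E_{\tilde f_t}\bigl[\|x_{t+1}-g_t(y_t)\|^2\,\big|\,Y_{t-1}\bigr]-\theta^{-1}\mathcal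 D_\tau(\tilde f_t\|\bar f_t),$$ with $\mathcal B_t$, $\mathcal G_t$, $\mathcal D_\tau$ as defined in the context. Then the optimal estimator is $$\hat x_{t+1}=g_t^\circ(y_t)=A_t\hat x_t+G_t(y_t-C_t\hat x_t).$$ The least favorable density $\tilde f_t^\circ$ is Gaussian with the same mean as $\bar f_t$. Its covariance coincides with $K_{z_t}$ except for the block of $x_{t+1}$, which is such that the conditional covariance of $x_{t+1}$ given $Y_t$ under $\tilde f_t^\circ$ is $$V_{t+1}=\begin{cases}L_{P_{t+1}}\bigl(I_n-\theta(1-\tau)L_{P_{t+1}}^TL_{P_{t+1}}\bigr)^{\frac1{\tau-1}}L_{P_{t+1}}^T,&0\le\tau<1,\\[2pt] L_{P_{t+1}}\exp\bigl(\theta L_{P_{t+1}}^TL_{P_{t+1}}\bigr)L_{P_{t+1}}^T,&\tau=1.\end{cases}$$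
   Context: Time $t$ and the past observations $Y_{t-1}=\{y_s:0\le s\le t-1\}$ are fixed. The vector $\hat x_t$ and the matrix $V_t$ depend only on $Y_{t-1}$ and the model. **$\tau$-divergence.** Let $f\sim\mathcal N(m,K)$ and $\tilde f\sim\mathcal N(\tilde m,\tilde K)$ be Gaussian densities on $\mathbb{R}^{N}$ with positive definite covariances. Let $K=LL^T$ with $L$ square, and $\Delta m=\tilde m-m$. Then $$\mathcal D_\tau(\tilde f\|f)=\begin{cases}\Delta m^TK^{-1}\Delta m+\operatorname{tr}\bigl(-\log(\tilde KK^{-1})+\tilde KK^{-1}-I_N\bigr),&\tau=0,\\ \frac1{1-\tau}\Delta m^TK^{-1}\Delta m+\operatorname{tr}\bigl(-\frac1{\tau(1-\tau)}(L^{-1}\tilde KL^{-T})^\tau+\frac1{1-\tau}\tilde KK^{-1}+\frac1\tau I_N\bigr),&0<\tau<1,\\ \delta_\infty(\Delta m)+\operatorname{tr}\bigl(L^{-1}\tilde KL^{-T}\log(L^{-1}\tilde KL^{-T})-\tilde KK^{-1}+I_N\bigr),&\tau=1,\end{cases}$$ where $\delta_\infty(v)=0$ if $v=0$ and $+\infty$ otherwise. Real powers, exponentials and logarithms of symmetric positive definite matrices are the usual matrix functions; $\operatorname{tr}\log(\tilde KK^{-1})=\log\det(\tilde KK^{-1})$. **Feasible sets.** $\mathcal B_t$ is the set of Gaussian densities $\tilde f_t(z_t|Y_{t-1})$ on $\mathbb{R}^{n+p}$ with positive definite covariance and $\mathcal D_\tau(\tilde f_t\|\bar f_t)<\infty$.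 $\mathcal G_t$ is the set of measurable $g_t:\mathbb{R}^p\to\mathbb{R}^n$ (dependence on $Y_{t-1}$ suppressed) such that $\mathbb E_{\tilde f_t}[\|g_t(y_t)\|^2|Y_{t-1}]$ is finite for every $\tilde f_t\in\mathcal B_t$. The conditional expectation of a function of $z_t$ given $Y_{t-1}$ under $\tilde f_t$ is its integral against $\tilde f_t(z_t|Y_{t-1})\,\mathrm dz_t$. **Solution of the minimax problem.** The optimal estimator $g_t^\circ\in\mathcal G_t$ minimizes over $g_t\in\mathcal G_t$ the supremum over $\tilde f_t\in\mathcal B_t$ of the objective. The least favorable density $\tilde f_t^\circ\in\mathcal B_t$ maximizes the objective when $g_t=g_t^\circ$. $A<B$ for symmetric matrices means $B-A$ is positive definite; $\|\cdot\|$ on vectors is the Euclidean norm. *)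

theory Defs
  imports "HOL-Analysis.Analysis"
begin

section \<open>Matrices\<close>

definition pos_def_matrix :: "real^'k^'k \<Rightarrow> bool" where
  "pos_def_matrix A \<longleftrightarrow> transpose A = A \<and> (\<forall>x. x \<noteq> 0 \<longrightarrow> 0 < x \<bullet> (A *v x))"

text \<open>The strict Loewner order. The order \<open><\<close> that the library puts on vectors is componentwise.\<close>

definition matrix_less :: "real^'k^'k \<Rightarrow> real^'k^'k \<Rightarrow> bool" where
  "matrix_less A B \<longleftrightarrow> pos_def_matrix (B - A)"

definition diag_matrix :: "('k \<Rightarrow> real) \<Rightarrow> real^'k^'k" where
  "diag_matrix d = (\<chi> i j. if i = j then d i else 0)"

text \<open>The function \<open>h\<close> of a symmetric matrix: \<open>h\<close> acts on the eigenvalues. The result does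
  not depend on the orthogonal diagonalisation. Real powers, exponentials and logarithms of matrices
  are the cases \<open>h = (\<lambda>x. x powr a)\<close>, \<open>h = exp\<close> and \<open>h = ln\<close>.\<close>

definition matrix_fun :: "(real \<Rightarrow> real) \<Rightarrow> real^'k^'k \<Rightarrow> real^'k^'k" where
  "matrix_fun h A = (THE B. \<exists>Q d. orthogonal_matrix Q
      \<and> A = Q ** diag_matrix d ** transpose Q
      \<and> B = Q ** diag_matrix (\<lambda>i. h (d i)) ** transpose Q)"

text \<open>Vertical concatenation. It serves for column vectors (\<open>'a = real\<close>) and, since matrices
  are vectors of rows, for block matrices.\<close>

definition stack :: "'a^'n \<Rightarrow> 'a^'p \<Rightarrow> 'a^('n + 'p)" where
  "stack u v = (\<chi> k. case k of Inl i \<Rightarrow> u $ i | Inr j \<Rightarrow> v $ j)"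

definition upper :: "'a^('n::finite + 'p::finite) \<Rightarrow> 'a^'n" where
  "upper z = (\<chi> i. z $ Inl i)"

definition lower :: "'a^('n::finite + 'p::finite) \<Rightarrow> 'a^'p" where
  "lower z = (\<chi> j. z $ Inr j)"


section \<open>Densities\<close>

definition gaussian_density :: "real^'k \<Rightarrow> real^'k^'k \<Rightarrow> real^'k \<Rightarrow> real" where
  "gaussian_density m K z =
     exp (- (1/2) * ((z - m) \<bullet> (matrix_inv K *v (z - m)))) / sqrt ((2 * pi) ^ CARD('k) * det K)"

definition density_expectation :: "(real^'k \<Rightarrow> real) \<Rightarrow> (real^'k \<Rightarrow> real) \<Rightarrow> real" where
  "density_expectation f h = (\<integral>z. h z * f z \<partial>lborel)"

definition density_mean :: "(real^'k \<Rightarrow> real) \<Rightarrow> real^'k" where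
  "density_mean f = (\<chi> i. density_expectation f (\<lambda>z. z $ i))"

definition density_cov :: "(real^'k \<Rightarrow> real) \<Rightarrow> real^'k^'k" where
  "density_cov f = (\<chi> i j. density_expectation f
      (\<lambda>z. (z $ i - density_mean f $ i) * (z $ j - density_mean f $ j)))"

text \<open>The conditional density of the upper component given that the lower one equals \<open>y\<close>.\<close>

definition cond_density ::
    "(real^('n::finite + 'p::finite) \<Rightarrow> real) \<Rightarrow> real^'p \<Rightarrow> real^'n \<Rightarrow> real" where
  "cond_density f y x = f (stack x y) / (\<integral>x'. f (stack x' y) \<partial>lborel)"


section \<open>The divergence and the minimax problem\<close>

definition delta_infty :: "real^'k \<Rightarrow> ereal" where
  "delta_infty v = (if v = 0 then 0 else \<infinity>)"

text \<open>The divergence of \<open>ft\<close> from \<open>f\<close>, for Gaussian densities with positive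
  definite covariances. The argument \<open>L\<close> is a square factor of the covariance of \<open>f\<close>,
  \<open>density_cov f = L ** transpose L\<close>; statements have to assume this. In the case
  \<open>\<tau> = 0\<close>, the term \<open>ln (det _)\<close> is the trace of the logarithm of a matrix that
  need not be symmetric.\<close>

definition tau_divergence ::
    "real \<Rightarrow> real^'k^'k \<Rightarrow> (real^'k \<Rightarrow> real) \<Rightarrow> (real^'k \<Rightarrow> real) \<Rightarrow> ereal" where
  "tau_divergence \<tau> L ft f =
    (let \<Delta> = density_mean ft - density_mean f;
         K = density_cov f;
         Kt = density_cov ft;
         X = matrix_inv L ** Kt ** transpose (matrix_inv L);
         q = \<Delta> \<bullet> (matrix_inv K *v \<Delta>)
     in if \<tau> = 0 then
          ereal (q + (- ln (det (Kt ** matrix_inv K)) + trace (Kt ** matrix_inv K - mat 1)))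
        else if \<tau> < 1 then
          ereal (1 / (1 - \<tau>) * q
            + trace (- (1 / (\<tau> * (1 - \<tau>))) *\<^sub>R matrix_fun (\<lambda>x. x powr \<tau>) X
                + (1 / (1 - \<tau>)) *\<^sub>R (Kt ** matrix_inv K) + (1 / \<tau>) *\<^sub>R mat 1))
        else
          delta_infty \<Delta>
            + ereal (trace (X ** matrix_fun ln X - Kt ** matrix_inv K + mat 1)))"

text \<open>The density \<open>fbar\<close> is the nominal one, and \<open>L\<close> is a factor of its covariance.\<close>

definition ambiguity_set ::
    "real \<Rightarrow> real^'k^'k \<Rightarrow> (real^'k \<Rightarrow> real) \<Rightarrow> (real^'k \<Rightarrow> real) set" where
  "ambiguity_set \<tau> L fbar = {ft. (\<exists>m K. pos_def_matrix K \<and> ft = gaussian_density m K)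
      \<and> tau_divergence \<tau> L ft fbar < \<infinity>}"

definition estimator_set ::
    "real \<Rightarrow> real^('n + 'p)^('n + 'p) \<Rightarrow> (real^('n::finite + 'p::finite) \<Rightarrow> real)
      \<Rightarrow> (real^'p \<Rightarrow> real^'n) set" where
  "estimator_set \<tau> L fbar = {g \<in> borel_measurable borel.
      \<forall>ft \<in> ambiguity_set \<tau> L fbar. integrable lborel (\<lambda>z. (norm (g (lower z)))\<^sup>2 * ft z)}"

text \<open>On \<open>estimator_set\<close> and \<open>ambiguity_set\<close> the expected squared error is that of an
  integrable function.\<close>

definition risk_objective ::
    "real \<Rightarrow> real \<Rightarrow> real^('n + 'p)^('n + 'p) \<Rightarrow> (real^('n::finite + 'p::finite) \<Rightarrow> real)
      \<Rightarrow> (real^'p \<Rightarrow> real^'n) \<Rightarrow> (real^('n + 'p) \<Rightarrow> real) \<Rightarrow> ereal" where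
  "risk_objective \<tau> \<theta> L fbar g ft =
     ereal (density_expectation ft (\<lambda>z. (norm (upper z - g (lower z)))\<^sup>2))
       - ereal (1 / \<theta>) * tau_divergence \<tau> L ft fbar"

definition optimal_estimator ::
    "real \<Rightarrow> real \<Rightarrow> real^('n + 'p)^('n + 'p) \<Rightarrow> (real^('n::finite + 'p::finite) \<Rightarrow> real)
      \<Rightarrow> (real^'p \<Rightarrow> real^'n) \<Rightarrow> bool" where
  "optimal_estimator \<tau> \<theta> L fbar = is_arg_min
     (\<lambda>g. SUP ft \<in> ambiguity_set \<tau> L fbar. risk_objective \<tau> \<theta> L fbar g ft)
     (\<lambda>g. g \<in> estimator_set \<tau> L fbar)"

definition least_favorable ::
    "real \<Rightarrow> real \<Rightarrow> real^('n + 'p)^('n + 'p) \<Rightarrow> (real^('n::finite + 'p::finite) \<Rightarrow> real)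
      \<Rightarrow> (real^'p \<Rightarrow> real^'n) \<Rightarrow> (real^('n + 'p) \<Rightarrow> real) \<Rightarrow> bool" where
  "least_favorable \<tau> \<theta> L fbar g = is_arg_max
     (risk_objective \<tau> \<theta> L fbar g) (\<lambda>ft. ft \<in> ambiguity_set \<tau> L fbar)"

end

theory Submission
  imports Defs "HOL-Probability.Probability"
begin

text \<open>
  Let \<open>L\<close> be a factor of the nominal covariance and \<open>M (x, y) = x - G y\<close>. At the Bayes
  estimator and at the Gaussian density of mean \<open>m + L w\<close> and covariance \<open>L X L\<^sup>T\<close>, the
  objective is \<open>tr (N X) - \<theta>\<^sup>-\<^sup>1 tr (\<phi> X)\<close> plus a quadratic form in \<open>w\<close>, where \<open>H = M L\<close>,
  \<open>N = H\<^sup>T H\<close> and \<open>\<phi>\<close> is a scalar function. The quadratic form is negative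
  definite since \<open>H H\<^sup>T = P\<close>. In eigenbases of \<open>N\<close> and \<open>X\<close> the trace term is a doubly stochastic
  average of scalar expressions \<open>\<nu> x - \<theta>\<^sup>-\<^sup>1 \<phi> x\<close>, each of which has a unique maximiser
  \<open>x = \<psi> \<nu>\<close>; hence \<open>X = \<psi> N\<close> is the unique maximiser. Since \<open>\<psi> 0 = 1\<close>, the covariance
  \<open>L (\<psi> N) L\<^sup>T\<close> differs from the nominal one only in the block of \<open>x\<close>. So the regression of \<open>x\<close> on
  \<open>y\<close> is unchanged, the Bayes estimator is also optimal against the maximising density, and the two
  form a saddle point.
\<close>

subsection \<open>Functions of symmetric matrices\<close>

text \<open>The coordinates \<open>w\<close> and \<open>X\<close> whiten the nominal law, which sits
  at \<open>w = 0\<close>, \<open>X = mat 1\<close>; the divergence then no longer sees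
  \<open>L\<close>. The bound on \<open>P\<close> is used twice: for the sign of the form in
  \<open>w\<close>, and to keep the base of the power in \<psi> positive at every eigenvalue of
  \<open>N\<close>. For \<tau> = 1 finite divergence forces \<open>w = 0\<close> and \<psi> is an
  exponential. The obstacle in maximising over \<open>X\<close> is that \<open>X\<close> and
  \<open>N\<close> need not commute; averaging over pairs of eigenvalues avoids any matrix
  inequality and carries strictness along. That \<psi> is 1 at 0 reflects that \<phi> is smallest at
  1. Only one block moves because \<psi>(\<open>N\<close>) - 1 has the form
  \<open>H\<^sup>T C H\<close>, and the range of \<open>L H\<^sup>T\<close> lies in the block of
  \<open>x\<close>. The factors of the joint covariance and of \<open>P\<close> in the statement are
  arbitrary and unrelated; both disappear once the result is expressed through \<open>P\<close>
  alone, by h(\<open>N\<close>) \<open>H\<^sup>T\<close> = \<open>H\<^sup>T\<close>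
  h(\<open>P\<close>). No minimax theorem enters: the two best responses bound the value from both
  sides.\<close>

lemma selfadjoint_eigenvector:
  fixes f :: "'a::euclidean_space \<Rightarrow> 'a"
  assumes f: "linear f" and sa: "\<And>x y. f x \<bullet> y = x \<bullet> f y"
    and S: "subspace S" "f ` S \<subseteq> S" "dim S \<noteq> 0"
  shows "\<exists>v\<in>S. norm v = 1 \<and> (\<exists>c. f v = c *\<^sub>R v)"
proof -
  \<comment> \<open>The eigenvector is a maximiser of the Rayleigh quotient on the unit sphere of
    \<open>S\<close>, and the maximum \<open>c\<close> is its eigenvalue.\<close>
  let ?T = "S \<inter> sphere 0 1"
  have "compact ?T"
    using closed_subspace[OF S(1)] by (simp add: closed_Int_compact)
  moreover obtain x where x: "x \<in> S" "x \<noteq> 0"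
    using S(3) by (metis dim_eq_0 subsetI singleton_iff)
  then have "(1 / norm x) *\<^sub>R x \<in> ?T"
    using S(1) by (simp add: subspace_scale)
  then have "?T \<noteq> {}" by blast
  moreover have "continuous_on ?T (\<lambda>x. x \<bullet> f x)"
    using f by (intro continuous_intros linear_continuous_on) (simp add: linear_conv_bounded_linear)
  ultimately obtain v where v: "v \<in> ?T" and vmax: "\<And>y. y \<in> ?T \<Longrightarrow> y \<bullet> f y \<le> v \<bullet> f v"
    using continuous_attains_sup by (metis (no_types, lifting))
  define c where "c = v \<bullet> f v"
  have vv: "v \<bullet> v = 1" using v by (simp add: dot_square_norm)
  have bound: "u \<bullet> f u \<le> c * (u \<bullet> u)" if "u \<in> S" for u
  proof (cases "u = 0")
    case False
    then have "(1 / norm u) *\<^sub>R u \<in> ?T"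
      using S(1) that by (simp add: subspace_scale)
    from vmax[OF this] have "(u \<bullet> f u) / (norm u)\<^sup>2 \<le> c"
      by (simp add: c_def linear_scale[OF f] power2_eq_square)
    then show ?thesis using False
      by (simp add: divide_le_eq power2_norm_eq_inner)
  qed (simp add: linear_0[OF f])
  \<comment> \<open>\<open>w\<close> is the residual of the eigenvalue equation. Moving from
    \<open>v\<close> along \<open>w\<close> changes the Rayleigh defect to first order by a multiple
    of \<open>w \<bullet> w\<close>, which maximality of \<open>v\<close> forbids unless
    \<open>w = 0\<close>.\<close>
  define w where "w = f v - c *\<^sub>R v"
  have wS: "w \<in> S" unfolding w_def using S v by (auto intro!: subspace_diff subspace_scale)
  define b where "b = c * (w \<bullet> w) - w \<bullet> f w"
  have main: "0 \<le> t\<^sup>2 * b - 2 * t * (w \<bullet> w)" for t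
  proof -
    have "v + t *\<^sub>R w \<in> S" using v wS S(1) by (auto intro!: subspace_add subspace_scale)
    from bound[OF this]
    have "0 \<le> c * ((v + t *\<^sub>R w) \<bullet> (v + t *\<^sub>R w)) - (v + t *\<^sub>R w) \<bullet> f (v + t *\<^sub>R w)" by simp
    also have "\<dots> = t\<^sup>2 * b - 2 * t * (w \<bullet> f v - c * (w \<bullet> v))"
      using sa[of w v] sa[of v w] vv unfolding b_def
      by (simp add: linear_add[OF f] linear_scale[OF f] inner_add_left inner_add_right
          c_def[symmetric] inner_commute algebra_simps power2_eq_square)
    also have "w \<bullet> f v - c * (w \<bullet> v) = w \<bullet> w"
      by (simp add: w_def inner_diff_right inner_diff_left algebra_simps)
    finally show ?thesis .
  qed
  have "w \<bullet> w \<le> 0"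
  proof (cases "b \<le> 0")
    case True
    then show ?thesis using main[of 1] by simp
  next
    case False
    have "(w \<bullet> w)\<^sup>2 / b \<le> 0"
      using main[of "(w \<bullet> w) / b"] False by (simp add: power2_eq_square field_simps)
    then show ?thesis using False by (simp add: divide_le_0_iff)
  qed
  then have "w = 0" by (metis inner_ge_zero inner_eq_zero_iff antisym)
  then show ?thesis using v by (auto simp: w_def)
qed

text \<open>Split off one unit eigenvector and recurse into its orthogonal complement within
  \<open>S\<close>, which self-adjointness keeps invariant.\<close>

lemma selfadjoint_eigenbasis:
  fixes f :: "'a::euclidean_space \<Rightarrow> 'a"
  assumes f: "linear f" and sa: "\<And>x y. f x \<bullet> y = x \<bullet> f y"
  shows "subspace S \<Longrightarrow> f ` S \<subseteq> S \<Longrightarrow>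
    \<exists>B. finite B \<and> B \<subseteq> S \<and> card B = dim S \<and> pairwise orthogonal B
      \<and> (\<forall>b\<in>B. norm b = 1 \<and> (\<exists>c. f b = c *\<^sub>R b))"
proof (induction "dim S" arbitrary: S)
  case 0
  then show ?case by (intro exI[of _ "{}"]) (auto simp: pairwise_def)
next
  case (Suc d)
  then obtain v c where v: "v \<in> S" "norm v = 1" "f v = c *\<^sub>R v"
    using selfadjoint_eigenvector[OF f sa] by (metis nat.simps(3))
  define S' where "S' = {y \<in> S. \<forall>x \<in> span {v}. orthogonal x y}"
  have S': "y \<in> S' \<longleftrightarrow> y \<in> S \<and> v \<bullet> y = 0" for y
    unfolding S'_def by (auto simp: span_singleton orthogonal_def)
  have "dim S' + dim (span {v}) = dim S"
    unfolding S'_def using Suc.prems v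
    by (intro dim_subspace_orthogonal_to_vectors) (auto simp: span_minimal)
  moreover have "dim (span {v}) = 1" using v(2) by auto
  ultimately have dim: "d = dim S'" using Suc.hyps by simp
  have "subspace S'"
    using Suc.prems(1) unfolding subspace_def by (auto simp: S' inner_add_right)
  moreover have "f ` S' \<subseteq> S'"
  proof (intro subsetI, elim imageE)
    fix x y assume "x = f y" "y \<in> S'"
    then show "x \<in> S'"
      using Suc.prems(2) sa[of v y] v(3) by (auto simp: S')
  qed
  ultimately obtain B where B: "finite B" "B \<subseteq> S'" "card B = d" "pairwise orthogonal B"
      "\<forall>b\<in>B. norm b = 1 \<and> (\<exists>c. f b = c *\<^sub>R b)"
    using Suc.hyps(1)[OF dim] dim by metis
  have "v \<notin> S'" using v by (auto simp: S')
  then have "v \<notin> B" using B by auto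
  moreover have "pairwise orthogonal (insert v B)"
    using B S' by (auto simp: pairwise_insert orthogonal_def inner_commute)
  ultimately show ?case
    using B v Suc.hyps(2) S' by (intro exI[of _ "insert v B"]) auto
qed

lemma mult_diag_matrix_nth [simp]:
  fixes X :: "real^'k^'m"
  shows "(X ** diag_matrix d) $ i $ j = X $ i $ j * d j"
    and "(diag_matrix e ** X) $ i $ j = e i * X $ i $ j"
  by (simp_all add: matrix_matrix_mult_def diag_matrix_def if_distrib if_distribR cong: if_cong)

lemma transpose_diag_matrix [simp]: "transpose (diag_matrix d) = diag_matrix d"
  by (simp add: transpose_def diag_matrix_def vec_eq_iff)

lemma diag_matrix_mult: "diag_matrix d ** diag_matrix e = diag_matrix (\<lambda>i. d i * e i)"
  by (simp add: vec_eq_iff) (simp add: diag_matrix_def)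

theorem symmetric_matrix_diagonalization:
  fixes A :: "real^'k^'k"
  assumes "transpose A = A"
  obtains Q d where "orthogonal_matrix Q" "A = Q ** diag_matrix d ** transpose Q"
proof -
  have sa: "(A *v x) \<bullet> y = x \<bullet> (A *v y)" for x y
    using assms by (metis dot_lmul_matrix vector_transpose_matrix)
  obtain B where B: "finite B" "card B = CARD('k)" "pairwise orthogonal B"
      "\<forall>b\<in>B. norm b = 1 \<and> (\<exists>c. A *v b = c *\<^sub>R b)"
    using selfadjoint_eigenbasis[of "(*v) A" UNIV] sa by auto
  obtain e :: "'k \<Rightarrow> real^'k" where e: "bij_betw e UNIV B"
    using B by (metis finite_class.finite_UNIV finite_same_card_bij)
  then have eB: "e j \<in> B" for j by (auto simp: bij_betw_def)
  have "\<forall>j. \<exists>c. A *v e j = c *\<^sub>R e j" using B(4) eB by blast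
  then obtain d where d: "A *v e j = d j *\<^sub>R e j" for j by metis
  have inn: "e i \<bullet> e j = (if i = j then 1 else 0)" for i j
  proof (cases "i = j")
    case True then show ?thesis using B(4) eB by (simp add: dot_square_norm)
  next
    case False
    then have "e i \<noteq> e j" using e by (auto simp: bij_betw_def inj_on_def)
    then show ?thesis using B(3) eB False by (auto simp: pairwise_def orthogonal_def)
  qed
  define Q :: "real^'k^'k" where "Q = (\<chi> i j. e j $ i)"
  have "transpose Q ** Q = mat 1"
    using inn by (simp add: vec_eq_iff matrix_matrix_mult_def transpose_def Q_def mat_def inner_vec_def)
  then have Q: "orthogonal_matrix Q" by (simp add: orthogonal_matrix)
  have "A ** Q = Q ** diag_matrix d"
  proof -
    have "(A ** Q) $ i $ j = (A *v e j) $ i" for i j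
      by (simp add: matrix_matrix_mult_def matrix_vector_mult_def Q_def)
    then show ?thesis using d by (simp add: vec_eq_iff Q_def)
  qed
  then have "A = Q ** diag_matrix d ** transpose Q"
    using Q by (metis matrix_mul_assoc matrix_mul_rid orthogonal_matrix_def)
  with Q show ?thesis by (rule that)
qed

text \<open>In the two eigenbases \<open>T\<close> becomes \<open>U\<close>, and the hypothesis
  reads \<open>d i * U $ i $ j = U $ i $ j * e j\<close>: \<open>U\<close> links equal eigenvalues
  only, so any function of the eigenvalues passes through as well. \<open>T = mat 1\<close> makes
  \<open>matrix_fun\<close> well defined; a rectangular \<open>T\<close> relates the two Gram
  matrices of \<open>H\<close>.\<close>

lemma diagonalization_intertwine:
  fixes Q :: "real^'k^'k" and R :: "real^'m^'m" and T :: "real^'m^'k"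
  assumes Q: "orthogonal_matrix Q" and R: "orthogonal_matrix R"
    and eq: "(Q ** diag_matrix d ** transpose Q) ** T = T ** (R ** diag_matrix e ** transpose R)"
    and h: "\<And>i j. d i = e j \<Longrightarrow> h i = h' j"
  shows "(Q ** diag_matrix h ** transpose Q) ** T = T ** (R ** diag_matrix h' ** transpose R)"
proof -
  define U where "U = transpose Q ** T ** R"
  have Q': "transpose Q ** Q = mat 1" "Q ** transpose Q = mat 1"
    and R': "transpose R ** R = mat 1" "R ** transpose R = mat 1"
    using Q R by (auto simp: orthogonal_matrix_def)
  have T: "T = Q ** U ** transpose R"
    unfolding U_def by (metis Q'(2) R'(2) matrix_mul_assoc matrix_mul_lid matrix_mul_rid)
  have L: "(Q ** diag_matrix a ** transpose Q) ** T = Q ** (diag_matrix a ** U) ** transpose R" for a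
    unfolding T by (metis Q'(1) matrix_mul_assoc matrix_mul_rid)
  have M: "T ** (R ** diag_matrix a ** transpose R) = Q ** (U ** diag_matrix a) ** transpose R" for a
    unfolding T by (metis R'(1) matrix_mul_assoc matrix_mul_rid)
  have "diag_matrix d ** U = U ** diag_matrix e"
    using eq unfolding L M by (metis Q'(1) R'(1) matrix_mul_assoc matrix_mul_lid matrix_mul_rid)
  then have "d i * U $ i $ j = U $ i $ j * e j" for i j
    by (metis mult_diag_matrix_nth)
  then have "h i * U $ i $ j = U $ i $ j * h' j" for i j
    using h[of i j] by (metis mult.commute mult_cancel_left)
  then have "diag_matrix h ** U = U ** diag_matrix h'" by (simp add: vec_eq_iff)
  then show ?thesis unfolding L M by simp
qed

lemma matrix_fun_eq:
  assumes "orthogonal_matrix Q" "A = Q ** diag_matrix d ** transpose Q"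
  shows "matrix_fun h A = Q ** diag_matrix (\<lambda>i. h (d i)) ** transpose Q"
  unfolding matrix_fun_def
proof (rule the_equality)
  fix B assume "\<exists>R e. orthogonal_matrix R \<and> A = R ** diag_matrix e ** transpose R
    \<and> B = R ** diag_matrix (\<lambda>i. h (e i)) ** transpose R"
  then obtain R e where "orthogonal_matrix R" "A = R ** diag_matrix e ** transpose R"
    "B = R ** diag_matrix (\<lambda>i. h (e i)) ** transpose R" by blast
  then show "B = Q ** diag_matrix (\<lambda>i. h (d i)) ** transpose Q"
    using diagonalization_intertwine[of R Q e "mat 1" d "\<lambda>i. h (e i)" "\<lambda>i. h (d i)"] assms
    by simp
qed (use assms in blast)

lemma matrix_fun_intertwine:
  fixes A :: "real^'k^'k" and B :: "real^'m^'m"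
  assumes "transpose A = A" "transpose B = B" "A ** T = T ** B"
  shows "matrix_fun h A ** T = T ** matrix_fun h B"
proof -
  obtain Q d where Q: "orthogonal_matrix Q" "A = Q ** diag_matrix d ** transpose Q"
    using symmetric_matrix_diagonalization[OF assms(1)] .
  obtain R e where R: "orthogonal_matrix R" "B = R ** diag_matrix e ** transpose R"
    using symmetric_matrix_diagonalization[OF assms(2)] .
  show ?thesis
    unfolding matrix_fun_eq[OF Q] matrix_fun_eq[OF R]
    by (rule diagonalization_intertwine[OF Q(1) R(1) assms(3)[unfolded Q(2) R(2)]]) simp
qed

lemma transpose_matrix_fun:
  assumes "transpose A = A" shows "transpose (matrix_fun h A) = matrix_fun h A"
proof -
  obtain Q d where Q: "orthogonal_matrix Q" "A = Q ** diag_matrix d ** transpose Q"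
    using symmetric_matrix_diagonalization[OF assms] .
  show ?thesis unfolding matrix_fun_eq[OF Q]
    by (simp add: matrix_transpose_mul matrix_mul_assoc)
qed

section \<open>Algebra, traces and determinants of diagonalised matrices\<close>

lemma matrix_add_rdistrib: "(A + B) ** C = A ** C + B ** (C :: real^'n^'m)"
  by (simp add: vec_eq_iff matrix_matrix_mult_def sum.distrib distrib_right)

lemma transpose_add: "transpose (A + B) = transpose A + transpose B"
  by (simp add: vec_eq_iff transpose_def)

lemma transpose_diff: "transpose (A - B) = transpose A - transpose B"
  by (simp add: vec_eq_iff transpose_def)

lemma inner_matrix_transpose: "x \<bullet> (A *v y) = (transpose A *v x) \<bullet> (y :: real^'n)"
  using dot_lmul_matrix[of x A y] by simp

lemma trace_scaleR: "trace (c *\<^sub>R A) = c * trace (A :: real^'k^'k)"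
  by (simp add: trace_def sum_distrib_left)

lemma conjugate_diag_affine:
  assumes "orthogonal_matrix Q"
  shows "a *\<^sub>R mat 1 + b *\<^sub>R (Q ** diag_matrix d ** transpose Q)
    = Q ** diag_matrix (\<lambda>i. a + b * d i) ** transpose (Q :: real^'k^'k)"
proof -
  have eq: "diag_matrix (\<lambda>i. a + b * d i) = a *\<^sub>R mat 1 + b *\<^sub>R diag_matrix d"
    by (simp add: vec_eq_iff diag_matrix_def mat_def)
  have "a *\<^sub>R mat 1 = Q ** (a *\<^sub>R mat 1) ** transpose Q"
    using assms by (simp add: orthogonal_matrix_def matrix_scalar_ac flip: scalar_matrix_assoc)
  then show ?thesis
    by (simp add: eq matrix_add_ldistrib matrix_add_rdistrib matrix_scalar_ac
        flip: scalar_matrix_assoc)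
qed

text \<open>The covariance formulas of the theorem apply a power or \<open>exp\<close> to an affine
  image of a Gram matrix. This moves the affine map into the scalar function, where both formulas
  become \<open>tilt\<close>.\<close>

lemma matrix_fun_affine:
  assumes "transpose S = S"
  shows "matrix_fun h (a *\<^sub>R mat 1 + b *\<^sub>R S) = matrix_fun (\<lambda>x. h (a + b * x)) S"
proof -
  obtain Q d where Q: "orthogonal_matrix Q" "S = Q ** diag_matrix d ** transpose Q"
    using symmetric_matrix_diagonalization[OF assms] .
  show ?thesis
    using matrix_fun_eq[OF Q] matrix_fun_eq[OF Q(1) conjugate_diag_affine[OF Q(1)], of h a b d] Q
    by simp
qed

lemma conjugate_diag_mult:
  assumes "orthogonal_matrix Q"
  shows "(Q ** diag_matrix d ** transpose Q) ** (Q ** diag_matrix e ** transpose Q)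
    = Q ** diag_matrix (\<lambda>i. d i * e i) ** transpose (Q :: real^'k^'k)"
proof -
  have "(Q ** diag_matrix d ** transpose Q) ** (Q ** diag_matrix e ** transpose Q)
      = Q ** diag_matrix d ** (transpose Q ** Q) ** diag_matrix e ** transpose Q"
    by (simp only: matrix_mul_assoc)
  also have "\<dots> = Q ** (diag_matrix d ** diag_matrix e) ** transpose Q"
    using assms by (simp add: orthogonal_matrix_def matrix_mul_assoc)
  finally show ?thesis by (simp add: diag_matrix_mult)
qed

text \<open>At \<open>x = 0\<close> the quotient is the junk value \<open>0\<close>; it gets multiplied by an eigenvalue \<open>0\<close>.\<close>

lemma matrix_fun_gram:
  fixes H :: "real^'m^'k"
  assumes "h 0 = 1"
  shows "matrix_fun h (transpose H ** H)
    = mat 1 + transpose H ** matrix_fun (\<lambda>x. (h x - 1) / x) (H ** transpose H) ** H"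
proof -
  define N where "N = transpose H ** H"
  have N: "transpose N = N" by (simp add: N_def matrix_transpose_mul)
  obtain Q d where Q: "orthogonal_matrix Q" "N = Q ** diag_matrix d ** transpose Q"
    using symmetric_matrix_diagonalization[OF N] .
  let ?k = "\<lambda>x. (h x - 1) / x"
  have "matrix_fun ?k N ** transpose H = transpose H ** matrix_fun ?k (H ** transpose H)"
    by (rule matrix_fun_intertwine[OF N]) (simp_all add: N_def matrix_transpose_mul matrix_mul_assoc)
  then have "transpose H ** matrix_fun ?k (H ** transpose H) ** H = matrix_fun ?k N ** N"
    by (simp add: N_def matrix_mul_assoc)
  also have "\<dots> = Q ** diag_matrix (\<lambda>i. ?k (d i) * d i) ** transpose Q"
    unfolding matrix_fun_eq[OF Q] by (subst Q(2)) (rule conjugate_diag_mult[OF Q(1)])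
  finally have "mat 1 + transpose H ** matrix_fun ?k (H ** transpose H) ** H
      = Q ** diag_matrix (\<lambda>i. 1 + 1 * (?k (d i) * d i)) ** transpose Q"
    using conjugate_diag_affine[OF Q(1), of 1 1 "\<lambda>i. ?k (d i) * d i"] by simp
  also have "(\<lambda>i. 1 + 1 * (?k (d i) * d i)) = (\<lambda>i. h (d i))"
    using assms by (auto simp: fun_eq_iff)
  finally show ?thesis unfolding matrix_fun_eq[OF Q, folded N_def] using N_def matrix_fun_eq[OF Q] by simp
qed

lemma det_conjugate_diag:
  assumes "orthogonal_matrix Q"
  shows "det (Q ** diag_matrix d ** transpose Q) = (\<Prod>i\<in>UNIV. d i)"
proof -
  have "det Q * det Q = 1"
    using assms by (metis det_I det_mul det_transpose orthogonal_matrix_def)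
  moreover have "det (diag_matrix d) = (\<Prod>i\<in>UNIV. d i)"
    by (subst det_diagonal) (simp_all add: diag_matrix_def)
  ultimately show ?thesis by (simp add: det_mul)
qed

lemma trace_conjugate_diag:
  assumes "orthogonal_matrix Q"
  shows "trace (Q ** diag_matrix d ** transpose Q) = (\<Sum>i\<in>UNIV. d i)"
proof -
  have "trace (Q ** diag_matrix d ** transpose Q) = trace (transpose Q ** Q ** diag_matrix d)"
    using trace_mul_sym[of "Q ** diag_matrix d" "transpose Q"] by (simp add: matrix_mul_assoc)
  also have "\<dots> = trace (diag_matrix d)" using assms by (simp add: orthogonal_matrix_def)
  also have "\<dots> = (\<Sum>i\<in>UNIV. d i)" by (simp add: trace_def diag_matrix_def)
  finally show ?thesis .
qed

section \<open>Positive definite matrices\<close>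

lemma pos_def_matrix_sym: "pos_def_matrix K \<Longrightarrow> transpose K = K"
  by (simp add: pos_def_matrix_def)

lemma pos_def_matrix_congruence:
  fixes T :: "real^'m^'k"
  assumes K: "pos_def_matrix K" and T: "\<And>x. transpose T *v x = 0 \<Longrightarrow> x = 0"
  shows "pos_def_matrix (T ** K ** transpose T)"
  unfolding pos_def_matrix_def
proof (intro conjI allI impI)
  show "transpose (T ** K ** transpose T) = T ** K ** transpose T"
    using K by (simp add: matrix_transpose_mul matrix_mul_assoc pos_def_matrix_sym)
  fix x :: "real^'k" assume "x \<noteq> 0"
  then have "0 < (transpose T *v x) \<bullet> (K *v (transpose T *v x))"
    using K T unfolding pos_def_matrix_def by blast
  then show "0 < x \<bullet> (T ** K ** transpose T *v x)"
    by (simp add: inner_matrix_transpose flip: matrix_vector_mul_assoc)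
qed

lemma pos_def_matrix_diagonalization:
  assumes "pos_def_matrix K"
  obtains Q d where "orthogonal_matrix Q" "K = Q ** diag_matrix d ** transpose Q" "\<And>i. 0 < d i"
proof -
  obtain Q d where Q: "orthogonal_matrix Q" "K = Q ** diag_matrix d ** transpose Q"
    using symmetric_matrix_diagonalization[OF pos_def_matrix_sym[OF assms]] .
  have "0 < d i" for i
  proof -
    have Qx: "transpose Q *v (Q *v axis i 1) = axis i 1"
      using Q(1) by (simp add: matrix_vector_mul_assoc orthogonal_matrix_def del: transpose_matrix_vector)
    then have "Q *v axis i 1 \<noteq> 0"
      by (metis axis_eq_0_iff matrix_vector_mult_0_right zero_neq_one)
    then have "0 < (Q *v axis i 1) \<bullet> (K *v (Q *v axis i 1))"
      using assms unfolding pos_def_matrix_def by blast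
    also have "\<dots> = axis i 1 \<bullet> (diag_matrix d *v axis i 1)"
      using Qx by (simp add: Q(2) inner_matrix_transpose[of _ Q] flip: matrix_vector_mul_assoc
          del: transpose_matrix_vector)
    also have "\<dots> = d i"
      by (simp add: inner_axis' matrix_vector_mult_def diag_matrix_def)
        (simp add: axis_def if_distrib cong: if_cong)
    finally show ?thesis .
  qed
  with Q show ?thesis by (rule that)
qed

lemma pos_def_matrix_conjugate_diag:
  assumes "orthogonal_matrix Q" "\<And>i. 0 < d i"
  shows "pos_def_matrix (Q ** diag_matrix d ** transpose Q)"
proof (rule pos_def_matrix_congruence)
  show "pos_def_matrix (diag_matrix d)"
    unfolding pos_def_matrix_def
  proof (intro conjI allI impI)
    fix x :: "real^'a" assume "x \<noteq> 0"
    then obtain i where i: "x $ i \<noteq> 0" by (auto simp: vec_eq_iff)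
    have "x \<bullet> (diag_matrix d *v x) = (\<Sum>i\<in>UNIV. d i * (x $ i)\<^sup>2)"
      by (simp add: inner_vec_def matrix_vector_mult_def diag_matrix_def if_distrib if_distribR
          power2_eq_square mult_ac cong: if_cong)
    also have "\<dots> > 0"
      using i assms(2) by (intro sum_pos2[of _ i]) (auto simp: less_imp_le)
    finally show "0 < x \<bullet> (diag_matrix d *v x)" .
  qed simp
  fix x assume "transpose Q *v x = 0"
  then show "x = 0"
    using assms(1) by (metis matrix_vector_mul_assoc matrix_vector_mul_lid matrix_vector_mult_0_right
        orthogonal_matrix_def)
qed

lemma pos_def_matrix_det: "pos_def_matrix K \<Longrightarrow> 0 < det K"
  by (erule pos_def_matrix_diagonalization) (simp add: det_conjugate_diag prod_pos)

lemma pos_def_matrix_invertible: "pos_def_matrix K \<Longrightarrow> invertible K"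
  using pos_def_matrix_det[of K] by (simp add: invertible_det_nz)

lemma matrix_inv_left: "invertible A \<Longrightarrow> matrix_inv A ** A = mat 1"
  and matrix_inv_right: "invertible A \<Longrightarrow> A ** matrix_inv A = mat 1"
  using someI_ex[of "\<lambda>B. A ** B = mat 1 \<and> B ** A = mat 1"]
  unfolding invertible_def matrix_inv_def by blast+

text \<open>The squared entries of \<open>transpose Q ** R\<close> are doubly stochastic, so that both sides are
  averages, with the same weights, of the two sides of the scalar inequality.\<close>

lemma trace_variational_strict:
  fixes Q R :: "real^'k^'k"
  assumes Q: "orthogonal_matrix Q" and R: "orthogonal_matrix R"
    and scalar: "\<And>i j. x j \<noteq> y i \<Longrightarrow> n i * x j - f (x j) < n i * y i - f (y i)"
    and ne: "R ** diag_matrix x ** transpose R \<noteq> Q ** diag_matrix y ** transpose Q"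
  shows "trace ((Q ** diag_matrix n ** transpose Q) ** (R ** diag_matrix x ** transpose R))
      - (\<Sum>j\<in>UNIV. f (x j)) < (\<Sum>i\<in>UNIV. n i * y i - f (y i))"
proof -
  define W where "W = transpose Q ** R"
  have Q': "transpose Q ** Q = mat 1" "Q ** transpose Q = mat 1"
    and R': "transpose R ** R = mat 1" "R ** transpose R = mat 1"
    using Q R by (auto simp: orthogonal_matrix_def)
  have "W ** transpose W = mat 1" "transpose W ** W = mat 1"
    unfolding W_def matrix_transpose_mul transpose_transpose
    by (metis Q' R' matrix_mul_assoc matrix_mul_rid)+
  then have "(W ** transpose W) $ i $ i = 1" "(transpose W ** W) $ i $ i = 1" for i
    by (simp_all add: mat_def)
  then have row: "(\<Sum>j\<in>UNIV. (W $ i $ j)\<^sup>2) = 1" and col: "(\<Sum>j\<in>UNIV. (W $ j $ i)\<^sup>2) = 1" for i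
    by (simp_all add: matrix_matrix_mult_def transpose_def power2_eq_square)
  have "trace ((Q ** diag_matrix n ** transpose Q) ** (R ** diag_matrix x ** transpose R))
      = trace (Q ** (diag_matrix n ** W ** diag_matrix x ** transpose R))"
    by (simp add: W_def matrix_mul_assoc)
  also have "\<dots> = trace ((diag_matrix n ** W) ** (diag_matrix x ** transpose W))"
    by (subst trace_mul_sym) (simp add: W_def matrix_transpose_mul matrix_mul_assoc)
  also have "\<dots> = (\<Sum>i\<in>UNIV. \<Sum>j\<in>UNIV. (W $ i $ j)\<^sup>2 * (n i * x j))"
    by (simp add: trace_def matrix_matrix_mult_def[of "diag_matrix n ** W"] transpose_def
        power2_eq_square mult_ac)
  finally have tr: "trace ((Q ** diag_matrix n ** transpose Q) ** (R ** diag_matrix x ** transpose R))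
      = (\<Sum>i\<in>UNIV. \<Sum>j\<in>UNIV. (W $ i $ j)\<^sup>2 * (n i * x j))" .
  have "(\<Sum>j\<in>UNIV. f (x j)) = (\<Sum>j\<in>UNIV. \<Sum>i\<in>UNIV. (W $ i $ j)\<^sup>2 * f (x j))"
    by (simp add: col flip: sum_distrib_right)
  also have "\<dots> = (\<Sum>i\<in>UNIV. \<Sum>j\<in>UNIV. (W $ i $ j)\<^sup>2 * f (x j))"
    by (rule sum.swap)
  finally have "trace ((Q ** diag_matrix n ** transpose Q) ** (R ** diag_matrix x ** transpose R))
      - (\<Sum>j\<in>UNIV. f (x j)) = (\<Sum>i\<in>UNIV. \<Sum>j\<in>UNIV. (W $ i $ j)\<^sup>2 * (n i * x j - f (x j)))"
    by (simp add: tr right_diff_distrib sum_subtractf)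
  also have "\<dots> = (\<Sum>(i, j)\<in>UNIV. (W $ i $ j)\<^sup>2 * (n i * x j - f (x j)))"
    by (simp add: sum.cartesian_product)
  also have "\<dots> < (\<Sum>(i, j)\<in>UNIV. (W $ i $ j)\<^sup>2 * (n i * y i - f (y i)))"
  proof (rule sum_strict_mono_ex1)
    have le: "n i * x j - f (x j) \<le> n i * y i - f (y i)" for i j
      using scalar[of j i] by (cases "x j = y i") auto
    then show "\<forall>p\<in>UNIV. (case p of (i, j) \<Rightarrow> (W $ i $ j)\<^sup>2 * (n i * x j - f (x j)))
        \<le> (case p of (i, j) \<Rightarrow> (W $ i $ j)\<^sup>2 * (n i * y i - f (y i)))"
      by (auto intro!: mult_left_mono)
    \<comment> \<open>Strictness: if unequal eigenvalues never met a nonzero weight,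
      \<open>W\<close> would intertwine the two diagonal matrices, and the two matrices themselves
      would coincide.\<close>
    obtain i j where ij: "W $ i $ j \<noteq> 0" "x j \<noteq> y i"
    proof (rule ccontr)
      assume "\<not> thesis"
      then have "W ** diag_matrix x = diag_matrix y ** W"
        using that by (auto simp: vec_eq_iff)
      then have "Q ** (W ** diag_matrix x) ** transpose R = Q ** (diag_matrix y ** W) ** transpose R"
        by simp
      then show False
        using ne unfolding W_def by (metis Q'(2) R'(2) matrix_mul_assoc matrix_mul_lid matrix_mul_rid)
    qed
    then show "\<exists>p\<in>UNIV. (case p of (i, j) \<Rightarrow> (W $ i $ j)\<^sup>2 * (n i * x j - f (x j)))
        < (case p of (i, j) \<Rightarrow> (W $ i $ j)\<^sup>2 * (n i * y i - f (y i)))"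
      using scalar[OF ij(2)] ij(1) by (intro bexI[of _ "(i, j)"]) (auto intro!: mult_strict_left_mono)
  qed simp
  also have "\<dots> = (\<Sum>i\<in>UNIV. \<Sum>j\<in>UNIV. (W $ i $ j)\<^sup>2 * (n i * y i - f (y i)))"
    by (simp add: sum.cartesian_product)
  also have "\<dots> = (\<Sum>i\<in>UNIV. n i * y i - f (y i))"
    by (simp add: row flip: sum_distrib_right)
  finally show ?thesis .
qed

subsection \<open>Invariance of Lebesgue measure\<close>

declare transpose_matrix_vector [simp del]

lemma borel_measurable_linear:
  fixes T :: "'a::euclidean_space \<Rightarrow> 'b::euclidean_space"
  assumes "linear T" shows "T \<in> borel_measurable borel"
  using assms
  by (simp add: borel_measurable_continuous_onI linear_continuous_on linear_conv_bounded_linear)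

lemma continuous_on_matrix_vector_mult [continuous_intros]:
  fixes A :: "real^'n^'m"
  assumes "continuous_on S f" shows "continuous_on S (\<lambda>x. A *v f x)"
  using matrix_vector_mult_linear_continuous_on[of UNIV A] assms
  by (rule continuous_on_compose2) auto

lemma measurable_matrix_vector_mult [measurable]:
  fixes A :: "real^'n^'m"
  shows "(*v) A \<in> borel_measurable borel"
  by (intro borel_measurable_continuous_onI continuous_intros)

lemma measurable_vec_nth [measurable]: "(\<lambda>x :: real^'n. x $ i) \<in> borel_measurable borel"
  by (intro borel_measurable_continuous_onI continuous_intros)

lemma nn_integral_lborel_translate:
  fixes f :: "'a::euclidean_space \<Rightarrow> ennreal"
  assumes [measurable]: "f \<in> borel_measurable borel"
  shows "(\<integral>\<^sup>+x. f (a + x) \<partial>lborel) = (\<integral>\<^sup>+x. f x \<partial>lborel)"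
  by (subst lborel_distr_plus[of a, symmetric], subst nn_integral_distr) auto

lemma nn_integral_lborel_reflect:
  fixes f :: "'a::euclidean_space \<Rightarrow> ennreal"
  assumes [measurable]: "f \<in> borel_measurable borel"
  shows "(\<integral>\<^sup>+x. f (a - x) \<partial>lborel) = (\<integral>\<^sup>+x. f x \<partial>lborel)"
  by (subst (2) lborel_affine[of "-1" a]) (simp_all add: nn_integral_density nn_integral_distr)

text \<open>Fubini and the translation invariance of \<open>lborel\<close> give the proportionality of \<open>lborel\<close>
  and of its image under \<open>T\<close> without any computation of a determinant.\<close>

lemma nn_integral_lborel_linear_proportional:
  fixes T T' :: "'a::euclidean_space \<Rightarrow> 'a"
  assumes T: "linear T" "linear T'" "\<And>x. T (T' x) = x"
    and [measurable]: "f \<in> borel_measurable borel" "g \<in> borel_measurable borel"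
  shows "(\<integral>\<^sup>+x. f (T x) \<partial>lborel) * (\<integral>\<^sup>+y. g y \<partial>lborel)
    = (\<integral>\<^sup>+x. g (T x) \<partial>lborel) * (\<integral>\<^sup>+y. f y \<partial>lborel)"
proof -
  have [measurable]: "T \<in> borel_measurable borel" "T' \<in> borel_measurable borel"
    using T by (simp_all add: borel_measurable_linear)
  have "(\<integral>\<^sup>+x. f (T x) \<partial>lborel) * (\<integral>\<^sup>+y. g y \<partial>lborel)
      = (\<integral>\<^sup>+x. \<integral>\<^sup>+y. f (T x) * g y \<partial>lborel \<partial>lborel)"
    by (simp add: nn_integral_cmult nn_integral_multc)
  also have "\<dots> = (\<integral>\<^sup>+x. \<integral>\<^sup>+y. f (T x) * g (T x + y) \<partial>lborel \<partial>lborel)"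
    by (simp add: nn_integral_cmult nn_integral_lborel_translate)
  also have "\<dots> = (\<integral>\<^sup>+y. \<integral>\<^sup>+x. f (T x) * g (T x + y) \<partial>lborel \<partial>lborel)"
    by (rule lborel_pair.Fubini') simp
  \<comment> \<open>Shifting \<open>x\<close> by \<open>- T' y\<close> turns \<open>T x\<close> into
    \<open>T x - y\<close>. This frees \<open>g\<close> from \<open>y\<close>, and a reflection of
    \<open>y\<close> then decouples the two integrals.\<close>
  also have "\<dots> = (\<integral>\<^sup>+y. \<integral>\<^sup>+x. f (T (- T' y + x)) * g (T (- T' y + x) + y) \<partial>lborel \<partial>lborel)"
    using nn_integral_lborel_translate[of "\<lambda>x. f (T x) * g (T x + y)" "- T' y" for y] by simp
  also have "\<dots> = (\<integral>\<^sup>+y. \<integral>\<^sup>+x. f (T x - y) * g (T x) \<partial>lborel \<partial>lborel)"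
    using T by (simp add: linear_add linear_diff linear_neg)
  also have "\<dots> = (\<integral>\<^sup>+x. \<integral>\<^sup>+y. f (T x - y) * g (T x) \<partial>lborel \<partial>lborel)"
    by (rule lborel_pair.Fubini') simp
  also have "\<dots> = (\<integral>\<^sup>+x. g (T x) * (\<integral>\<^sup>+y. f (T x - y) \<partial>lborel) \<partial>lborel)"
    by (simp add: nn_integral_cmult nn_integral_multc mult.commute)
  also have "\<dots> = (\<integral>\<^sup>+x. g (T x) \<partial>lborel) * (\<integral>\<^sup>+y. f y \<partial>lborel)"
    by (simp add: nn_integral_lborel_reflect nn_integral_multc)
  finally show ?thesis .
qed

text \<open>Testing the proportionality on a single set \<open>B\<close> that \<open>T\<close>
  preserves fixes the factor at 1, because \<open>B\<close> has finite and nonzero measure.\<close>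

lemma lborel_linear_invariant:
  fixes T T' :: "'a::euclidean_space \<Rightarrow> 'a"
  assumes T: "linear T" "linear T'" "\<And>x. T (T' x) = x"
    and B: "open B" "bounded B" "B \<noteq> {}" "T -` B = B"
  shows "distr lborel borel T = lborel"
proof (rule measure_eqI)
  have [measurable]: "T \<in> borel_measurable borel"
    using T by (simp_all add: borel_measurable_linear)
  fix A assume "A \<in> sets (distr lborel borel T)"
  then have [measurable]: "A \<in> sets borel" by simp
  have [measurable]: "B \<in> sets borel" "T -` A \<in> sets borel"
    using B measurable_sets_borel[of T borel A] by simp_all
  have TB: "indicator B (T x) = (indicator B x :: ennreal)" for x
    using B(4) by (auto split: split_indicator)
  have "emeasure lborel (T -` A) * emeasure lborel B = emeasure lborel B * emeasure lborel A"
    using nn_integral_lborel_linear_proportional[OF T, of "indicator A" "indicator B"]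
    by (simp add: TB indicator_vimage[of T A, unfolded comp_def, symmetric] del: indicator_simps)
  moreover have "emeasure lborel B \<noteq> 0"
  proof -
    obtain x e where e: "0 < e" "ball x e \<subseteq> B" using B(1,3) by (meson all_not_in_conv openE)
    have "0 < emeasure lborel (ball x e)" using e(1) by (simp add: emeasure_ball)
    also have "\<dots> \<le> emeasure lborel B" using e(2) by (intro emeasure_mono) auto
    finally show ?thesis by simp
  qed
  moreover have "emeasure lborel B \<noteq> \<infinity>"
    using emeasure_bounded_finite[OF B(2)] by simp
  ultimately have "emeasure lborel (T -` A) = emeasure lborel A"
    by (metis ennreal_mult_cancel_left infinity_ennreal_def mult.commute)
  then show "emeasure (distr lborel borel T) A = emeasure lborel A"
    by (simp add: emeasure_distr)
qed simp

lemma lborel_orthogonal_invariant: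
  assumes "orthogonal_matrix (Q :: real^'k^'k)"
  shows "distr lborel borel ((*v) Q) = lborel"
proof (rule lborel_linear_invariant)
  show "Q *v (transpose Q *v x) = x" for x
    using assms by (simp add: matrix_vector_mul_assoc orthogonal_matrix_def del: transpose_matrix_vector)
  have "norm (Q *v x) = norm x" for x
    using assms by (metis orthogonal_transformation_matrix orthogonal_transformation_norm
        matrix_of_matrix_vector_mul matrix_vector_mul_linear)
  then show "(*v) Q -` ball 0 1 = ball 0 1" by auto
qed auto

text \<open>The unit ball intersected with its preimage is a preserved set, since the involution
  swaps the two. The map that will reverse the estimation error is an oblique reflection, so
  orthogonal invariance would not cover it.\<close>

lemma lborel_involution_invariant:
  fixes T :: "'a::euclidean_space \<Rightarrow> 'a"
  assumes T: "linear T" "\<And>x. T (T x) = x"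
  shows "distr lborel borel T = lborel"
proof (rule lborel_linear_invariant[OF T(1) T(1) T(2)])
  have "continuous_on UNIV T"
    using T(1) by (simp add: linear_continuous_on linear_conv_bounded_linear)
  then show "open (ball 0 1 \<inter> T -` ball 0 1)"
    by (intro open_Int open_ball open_vimage)
  show "ball 0 1 \<inter> T -` ball 0 1 \<noteq> {}"
    using linear_0[OF T(1)] centre_in_ball[of 0 1] by (metis Int_iff empty_iff vimageI2 zero_less_one)
  show "T -` (ball 0 1 \<inter> T -` ball 0 1) = ball 0 1 \<inter> T -` ball 0 1"
    using T(2) by auto
qed auto

section \<open>Product integrals and standard normal moments\<close>

lemma has_bochner_integral_lborel_prod:
  fixes f :: "'a::euclidean_space \<Rightarrow> real \<Rightarrow> real"
  assumes "\<And>b. b \<in> Basis \<Longrightarrow> has_bochner_integral lborel (f b) (I b)"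
  shows "has_bochner_integral lborel (\<lambda>x. \<Prod>b\<in>Basis. f b (x \<bullet> b)) (\<Prod>b\<in>Basis. I b)"
proof -
  interpret product_sigma_finite "\<lambda>_ :: 'a. lborel :: real measure" by standard
  have int: "integrable lborel (f b)" and I: "integral\<^sup>L lborel (f b) = I b" if "b \<in> Basis" for b
    using assms[OF that] by (auto simp: has_bochner_integral_iff)
  have [measurable]: "f b \<in> borel_measurable borel" if "b \<in> Basis" for b
    using borel_measurable_integrable[OF int[OF that]] by simp
  have "has_bochner_integral (\<Pi>\<^sub>M b\<in>(Basis :: 'a set). lborel) (\<lambda>x. \<Prod>b\<in>Basis. f b (x b)) (\<Prod>b\<in>Basis. I b)"
    using int I by (simp add: has_bochner_integral_iff product_integrable_prod product_integral_prod)
  then show ?thesis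
    by (subst lborel_eq) (auto intro!: has_bochner_integral_distr simp: comp_def)
qed

lemma
  fixes f :: "real^'k \<Rightarrow> 'a::comm_monoid_add"
  shows sum_Basis_vec: "(\<Sum>b\<in>Basis. f b) = (\<Sum>k\<in>UNIV. f (axis k 1))"
  and prod_Basis_vec: "(\<Prod>b\<in>Basis. g b) = (\<Prod>k\<in>UNIV. (g :: real^'k \<Rightarrow> real) (axis k 1))"
proof -
  have Basis: "(Basis :: (real^'k) set) = range (\<lambda>k. axis k 1)" by (auto simp: Basis_vec_def)
  have inj: "inj (\<lambda>k. axis k (1 :: real) :: real^'k)" by (auto simp: inj_on_def axis_eq_axis)
  show "(\<Sum>b\<in>Basis. f b) = (\<Sum>k\<in>UNIV. f (axis k 1))"
    "(\<Prod>b\<in>Basis. g b) = (\<Prod>k\<in>UNIV. g (axis k 1))"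
    by (simp_all add: Basis sum.reindex[OF inj] prod.reindex[OF inj])
qed

lemma diag_matrix_vector_mult_nth [simp]:
  fixes w :: "real^'k"
  shows "(diag_matrix s *v w) $ i = s i * w $ i"
  by (simp add: matrix_vector_mult_def diag_matrix_def if_distrib if_distribR cong: if_cong)

lemma has_bochner_integral_lborel_prod_vec:
  fixes f :: "'k::finite \<Rightarrow> real \<Rightarrow> real"
  assumes "\<And>k. has_bochner_integral lborel (f k) (I k)"
  shows "has_bochner_integral lborel (\<lambda>x :: real^'k. \<Prod>k\<in>UNIV. f k (x $ k)) (\<Prod>k\<in>UNIV. I k)"
proof -
  define idx :: "real^'k \<Rightarrow> 'k" where "idx b = (THE k. b = axis k 1)" for b
  have idx [simp]: "idx (axis k 1) = k" for k by (simp add: idx_def axis_eq_axis)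
  have "has_bochner_integral lborel (\<lambda>x :: real^'k. \<Prod>b\<in>Basis. f (idx b) (x \<bullet> b)) (\<Prod>b\<in>(Basis :: (real^'k) set). I (idx b))"
    by (intro has_bochner_integral_lborel_prod assms)
  then show ?thesis
    by (simp add: prod_Basis_vec inner_axis)
qed

text \<open>The one-dimensional standard normal has moments 1, 0, 1 of orders 0, 1, 2, which is what
  \<open>c\<close> records. Means and covariances involve no higher exponent in a single
  coordinate.\<close>

lemma std_normal_product_moment:
  defines "c \<equiv> (\<lambda>k :: nat. if k = 1 then 0 else 1)"
  assumes e: "\<And>k. e k \<le> 2"
  shows "has_bochner_integral lborel (\<lambda>x :: real^'k.
      (\<Prod>k\<in>UNIV. std_normal_density (x $ k)) * (\<Prod>k\<in>UNIV. (x $ k) ^ e k)) (\<Prod>k\<in>UNIV. c (e k))"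
proof -
  have "has_bochner_integral lborel (\<lambda>x. std_normal_density x * x ^ e k) (c (e k))" for k
  proof -
    consider "e k = 0" | "e k = 1" | "e k = 2" using e[of k] by linarith
    then show ?thesis
      using std_normal_moment_even[of 0] std_normal_moment_even[of 1] std_normal_moment_odd[of 0]
      by cases (simp_all add: c_def)
  qed
  from has_bochner_integral_lborel_prod_vec[OF this] show ?thesis
    by (simp add: prod.distrib)
qed

lemma std_normal_moments:
  defines "\<phi> \<equiv> (\<lambda>x :: real^'k. \<Prod>k\<in>UNIV. std_normal_density (x $ k))"
  shows "has_bochner_integral lborel \<phi> 1"
    and "has_bochner_integral lborel (\<lambda>x. \<phi> x * x $ i) 0"
    and "has_bochner_integral lborel (\<lambda>x. \<phi> x * (x $ i * x $ j)) (if i = j then 1 else 0)"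
proof -
  \<comment> \<open>Exponent vectors of the monomials. In \<open>\<delta> i k + \<delta> j k\<close>
    the value 1, which kills the product, occurs exactly if \<open>i \<noteq> j\<close>.\<close>
  define \<delta> :: "'k \<Rightarrow> 'k \<Rightarrow> nat" where "\<delta> i k = (if k = i then 1 else 0)" for i k
  have pow: "x ^ \<delta> i k = (if k = i then x else 1)" for x :: real and i k
    by (simp add: \<delta>_def)
  show "has_bochner_integral lborel \<phi> 1"
    using std_normal_product_moment[of "\<lambda>_. 0"] by (simp add: \<phi>_def)
  have *: "(\<Prod>k\<in>UNIV. if \<delta> i k = 1 then 0 else (1 :: real)) = 0"
    by (rule prod_zero) (auto simp: \<delta>_def)
  have "\<delta> i k \<le> 2" for k by (simp add: \<delta>_def)
  from std_normal_product_moment[of "\<delta> i", OF this] show "has_bochner_integral lborel (\<lambda>x. \<phi> x * x $ i) 0"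
    unfolding * by (simp add: \<phi>_def pow)
  have *: "(\<Prod>k\<in>UNIV. if \<delta> i k + \<delta> j k = 1 then 0 else (1 :: real)) = (if i = j then 1 else 0)"
    by (auto simp: \<delta>_def intro!: prod_zero prod.neutral)
  have "\<delta> i k + \<delta> j k \<le> 2" for k by (simp add: \<delta>_def)
  from std_normal_product_moment[of "\<lambda>k. \<delta> i k + \<delta> j k", OF this] show "has_bochner_integral lborel (\<lambda>x. \<phi> x * (x $ i * x $ j)) (if i = j then 1 else 0)"
    unfolding * by (simp add: \<phi>_def pow power_add prod.distrib)
qed


text \<open>The substitution is undone in three moves: scaling, rotation, translation. Only the
  diagonal scaling contributes a Jacobian.\<close>

lemma has_bochner_integral_lborel_conjugate:
  fixes F :: "real^'k \<Rightarrow> real" and Q :: "real^'k^'k"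
  assumes Q: "orthogonal_matrix Q" and s: "\<And>i. 0 < s i" and [measurable]: "F \<in> borel_measurable borel"
    and int: "has_bochner_integral lborel
      (\<lambda>w. (\<Prod>i\<in>UNIV. s i) * F (m + Q *v (diag_matrix s *v w))) I"
  shows "has_bochner_integral lborel F I"
proof -
  define idx :: "real^'k \<Rightarrow> 'k" where "idx b = (THE k. b = axis k 1)" for b
  have idx [simp]: "idx (axis k 1) = k" for k by (simp add: idx_def axis_eq_axis)
  have D: "(\<Sum>b\<in>Basis. (s (idx b) * (w \<bullet> b)) *\<^sub>R b) = diag_matrix s *v w" for w :: "real^'k"
    by (simp add: sum_Basis_vec inner_axis vec_eq_iff) (simp add: axis_def if_distrib cong: if_cong)
  have dens: "lborel = density (distr lborel borel ((*v) (diag_matrix s :: real^'k^'k)))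
      (\<lambda>_. ennreal (\<Prod>i\<in>UNIV. s i))"
    using lborel_affine_euclidean[of "\<lambda>b :: real^'k. s (idx b)" 0] s
    by (simp add: D prod_Basis_vec less_imp_le less_imp_neq[symmetric])
  have "has_bochner_integral lborel (\<lambda>y. F (m + Q *v y)) I"
    by (subst dens, intro has_bochner_integral_density has_bochner_integral_distr)
      (use int s in \<open>auto simp: less_imp_le prod_nonneg\<close>)
  then have "has_bochner_integral lborel (\<lambda>y. F (m + y)) I"
    by (subst lborel_orthogonal_invariant[OF Q, symmetric], intro has_bochner_integral_distr) auto
  then show ?thesis
    by (subst lborel_distr_plus[of m, symmetric], intro has_bochner_integral_distr) auto
qed

subsection \<open>Gaussian moments\<close>

lemma gaussian_density_measurable [measurable]:
  "gaussian_density m K \<in> borel_measurable borel"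
  unfolding gaussian_density_def[abs_def] divide_inverse
  by (intro borel_measurable_continuous_onI continuous_intros)

lemma gaussian_density_pos: "pos_def_matrix K \<Longrightarrow> 0 < gaussian_density m K z"
  by (simp add: gaussian_density_def pos_def_matrix_det)

text \<open>The square roots of the eigenvalues give both the Jacobian of the whitening substitution
  and \<open>sqrt (det K)\<close>, so the two cancel.\<close>

lemma gaussian_density_conjugate:
  fixes Q :: "real^'k^'k"
  assumes Q: "orthogonal_matrix Q" and K: "K = Q ** diag_matrix d ** transpose Q" and d: "\<And>i. 0 < d i"
  shows "(\<Prod>i\<in>UNIV. sqrt (d i))
      * gaussian_density m K (m + Q *v (diag_matrix (\<lambda>i. sqrt (d i)) *v w))
    = (\<Prod>k\<in>UNIV. std_normal_density (w $ k))"
proof -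
  let ?s = "\<lambda>i. sqrt (d i)"
  define u where "u = Q *v (diag_matrix ?s *v w)"
  have inv: "invertible K"
    using pos_def_matrix_invertible[OF pos_def_matrix_conjugate_diag[OF Q d]] K by simp
  \<comment> \<open>\<open>v\<close> is the expected value of \<open>matrix_inv K *v u\<close>.
    Checking \<open>K *v v = u\<close> replaces a diagonalisation of the inverse.\<close>
  define v where "v = Q *v (diag_matrix (\<lambda>i. 1 / ?s i) *v w)"
  have "K *v v = Q *v ((diag_matrix d ** (transpose Q ** Q) ** diag_matrix (\<lambda>i. 1 / ?s i)) *v w)"
    by (simp add: K v_def matrix_vector_mul_assoc matrix_mul_assoc)
  also have "\<dots> = u"
    using Q d unfolding u_def
    by (simp add: orthogonal_matrix_def real_div_sqrt less_imp_le matrix_vector_mul_assoc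
        flip: matrix_mul_assoc) (simp add: diag_matrix_mult real_div_sqrt less_imp_le)
  finally have "matrix_inv K *v u = (matrix_inv K ** K) *v v"
    by (simp flip: matrix_vector_mul_assoc)
  then have "matrix_inv K *v u = v"
    by (simp add: matrix_inv_left[OF inv])
  then have "u \<bullet> (matrix_inv K *v u) = u \<bullet> v" by simp
  also have "\<dots> = (transpose Q *v u) \<bullet> (diag_matrix (\<lambda>i. 1 / ?s i) *v w)"
    unfolding v_def by (rule inner_matrix_transpose)
  also have "transpose Q *v u = diag_matrix ?s *v w"
    using Q unfolding u_def by (metis matrix_vector_mul_assoc matrix_vector_mul_lid orthogonal_matrix_def)
  also have "(diag_matrix ?s *v w) \<bullet> (diag_matrix (\<lambda>i. 1 / ?s i) *v w) = (\<Sum>k\<in>UNIV. (w $ k)\<^sup>2)"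
    using d by (simp add: less_imp_neq[symmetric] inner_vec_def power2_eq_square)
  finally have quad: "u \<bullet> (matrix_inv K *v u) = (\<Sum>k\<in>UNIV. (w $ k)\<^sup>2)" .
  have det: "sqrt (det K) = (\<Prod>i\<in>UNIV. ?s i)"
    using d by (intro real_sqrt_unique)
      (simp_all add: K det_conjugate_diag[OF Q] prod_power_distrib less_imp_le prod_nonneg)
  have "0 < (\<Prod>i\<in>UNIV. ?s i)" using d by (simp add: prod_pos)
  then have "(\<Prod>i\<in>UNIV. ?s i) * gaussian_density m K (m + u)
      = exp (\<Sum>k\<in>UNIV. - (w $ k)\<^sup>2 / 2) / sqrt (2 * pi) ^ CARD('k)"
    by (simp add: gaussian_density_def quad real_sqrt_mult det real_sqrt_power sum_negf
        sum_divide_distrib power_mult_distrib less_imp_neq[OF d, symmetric])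
  also have "\<dots> = (\<Prod>k\<in>UNIV. std_normal_density (w $ k))"
    by (simp add: std_normal_density_def exp_sum prod_dividef)
  finally show ?thesis by (simp add: u_def)
qed

lemma gaussian_moments:
  fixes K :: "real^'k^'k"
  assumes "pos_def_matrix K"
  shows "has_bochner_integral lborel (gaussian_density m K) 1"
    and "has_bochner_integral lborel (\<lambda>z. gaussian_density m K z * (z - m) $ i) 0"
    and "has_bochner_integral lborel (\<lambda>z. gaussian_density m K z * ((z - m) $ i * (z - m) $ j)) (K $ i $ j)"
proof -
  obtain Q d where Q: "orthogonal_matrix Q" and K: "K = Q ** diag_matrix d ** transpose Q"
    and d: "\<And>i. 0 < d i"
    using pos_def_matrix_diagonalization[OF assms] by blast
  define T where "T = Q ** diag_matrix (\<lambda>i. sqrt (d i))"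
  let ?\<phi> = "\<lambda>x :: real^'k. \<Prod>k\<in>UNIV. std_normal_density (x $ k)"
  have TT: "T ** transpose T = K"
  proof -
    have "T ** transpose T = Q ** (diag_matrix (\<lambda>i. sqrt (d i)) ** diag_matrix (\<lambda>i. sqrt (d i))) ** transpose Q"
      by (simp add: T_def matrix_transpose_mul matrix_mul_assoc)
    then show ?thesis using d by (simp add: K diag_matrix_mult less_imp_le)
  qed
  \<comment> \<open>Substituting \<open>z = m + T *v w\<close> pulls integrals against the Gaussian
    density back to the standard normal one.\<close>
  have transfer: "has_bochner_integral lborel (\<lambda>z. gaussian_density m K z * f (z - m)) I"
    if [measurable]: "f \<in> borel_measurable borel"
      and "has_bochner_integral lborel (\<lambda>w. ?\<phi> w * f (T *v w)) I" for f I
    by (rule has_bochner_integral_lborel_conjugate[OF Q, where s = "\<lambda>i. sqrt (d i)" and m = m])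
      (use that(2) d in \<open>simp_all add: mult.assoc[symmetric] T_def
         gaussian_density_conjugate[OF Q K d, unfolded matrix_vector_mul_assoc] matrix_vector_mul_assoc\<close>)
  show "has_bochner_integral lborel (gaussian_density m K) 1"
    using transfer[of "\<lambda>_. 1"] std_normal_moments(1) by simp
  have Ti: "(T *v w) $ i = (\<Sum>a\<in>UNIV. T $ i $ a * w $ a)" for w i
    by (simp add: matrix_vector_mult_def)
  have "has_bochner_integral lborel (\<lambda>w. \<Sum>a\<in>UNIV. T $ i $ a * (?\<phi> w * w $ a)) (\<Sum>a\<in>UNIV. T $ i $ a * 0)"
    by (intro has_bochner_integral_sum has_bochner_integral_mult_right std_normal_moments)
  then show "has_bochner_integral lborel (\<lambda>z. gaussian_density m K z * (z - m) $ i) 0"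
    by (intro transfer) (simp_all add: Ti sum_distrib_left mult_ac)
  have "has_bochner_integral lborel
      (\<lambda>w. \<Sum>a\<in>UNIV. \<Sum>b\<in>UNIV. T $ i $ a * T $ j $ b * (?\<phi> w * (w $ a * w $ b)))
      (\<Sum>a\<in>UNIV. \<Sum>b\<in>UNIV. T $ i $ a * T $ j $ b * (if a = b then 1 else 0))"
    by (intro has_bochner_integral_sum has_bochner_integral_mult_right std_normal_moments)
  moreover have "(\<Sum>a\<in>UNIV. \<Sum>b\<in>UNIV. T $ i $ a * T $ j $ b * (if a = b then 1 else 0)) = K $ i $ j"
    unfolding TT[symmetric]
    by (simp add: matrix_matrix_mult_def transpose_def if_distrib cong: if_cong)
  moreover have "(\<Sum>a\<in>UNIV. \<Sum>b\<in>UNIV. T $ i $ a * T $ j $ b * (?\<phi> w * (w $ a * w $ b)))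
      = ?\<phi> w * ((T *v w) $ i * (T *v w) $ j)" for w
    unfolding Ti sum_product unfolding sum_distrib_left by (intro sum.cong refl) (simp only: mult_ac)
  ultimately show "has_bochner_integral lborel (\<lambda>z. gaussian_density m K z * ((z - m) $ i * (z - m) $ j)) (K $ i $ j)"
    by (intro transfer) simp_all
qed

lemma density_mean_gaussian [simp]:
  fixes K :: "real^'k^'k"
  assumes "pos_def_matrix K" shows "density_mean (gaussian_density m K) = m"
proof -
  have "density_expectation (gaussian_density m K) (\<lambda>z. z $ i) = m $ i" for i
  proof -
    have "has_bochner_integral lborel
        (\<lambda>z. gaussian_density m K z * (z - m) $ i + m $ i * gaussian_density m K z) (0 + m $ i * 1)"
      by (intro has_bochner_integral_add has_bochner_integral_mult_right gaussian_moments assms)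
    then show ?thesis
      by (simp add: density_expectation_def has_bochner_integral_iff algebra_simps)
  qed
  then show ?thesis by (simp add: density_mean_def vec_eq_iff)
qed

lemma density_cov_gaussian [simp]:
  fixes K :: "real^'k^'k"
  assumes "pos_def_matrix K" shows "density_cov (gaussian_density m K) = K"
  using gaussian_moments(3)[OF assms, of m] assms
  by (simp add: density_cov_def vec_eq_iff density_expectation_def has_bochner_integral_iff mult.commute)

text \<open>Expand around the mean: the linear part drops out because centred first moments vanish.
  This gives both the risk and the integrability of every affine estimator.\<close>

lemma gaussian_second_moment:
  fixes K :: "real^'k^'k" and M :: "real^'k^'q"
  assumes "pos_def_matrix K"
  shows "has_bochner_integral lborel (\<lambda>z. (norm (M *v z + c))\<^sup>2 * gaussian_density m K z)
    (trace (M ** K ** transpose M) + (norm (M *v m + c))\<^sup>2)"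
proof -
  define e where "e = M *v m + c"
  let ?f = "gaussian_density m K"
  have "has_bochner_integral lborel
      (\<lambda>z. \<Sum>q\<in>UNIV. (\<Sum>a\<in>UNIV. \<Sum>b\<in>UNIV. M $ q $ a * M $ q $ b * (?f z * ((z - m) $ a * (z - m) $ b)))
        + (\<Sum>a\<in>UNIV. 2 * e $ q * M $ q $ a * (?f z * (z - m) $ a)) + (e $ q)\<^sup>2 * ?f z)
      (\<Sum>q\<in>UNIV. (\<Sum>a\<in>UNIV. \<Sum>b\<in>UNIV. M $ q $ a * M $ q $ b * K $ a $ b)
        + (\<Sum>a\<in>UNIV. 2 * e $ q * M $ q $ a * 0) + (e $ q)\<^sup>2 * 1)"
    by (intro has_bochner_integral_add has_bochner_integral_sum has_bochner_integral_mult_right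
        gaussian_moments assms)
  moreover have "(\<Sum>q\<in>UNIV. (\<Sum>a\<in>UNIV. \<Sum>b\<in>UNIV. M $ q $ a * M $ q $ b * (?f z * ((z - m) $ a * (z - m) $ b)))
        + (\<Sum>a\<in>UNIV. 2 * e $ q * M $ q $ a * (?f z * (z - m) $ a)) + (e $ q)\<^sup>2 * ?f z)
      = (norm (M *v z + c))\<^sup>2 * ?f z" for z
  proof -
    define s where "s q = (\<Sum>a\<in>UNIV. M $ q $ a * (z - m) $ a)" for q
    have s: "(M *v z + c) $ q = s q + e $ q" for q
      by (simp add: s_def e_def matrix_vector_mult_def right_diff_distrib sum_subtractf)
    have "(norm (M *v z + c))\<^sup>2 * ?f z = (\<Sum>q\<in>UNIV. (s q + e $ q)\<^sup>2 * ?f z)"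
      unfolding power2_norm_eq_inner inner_vec_def
      by (simp add: s power2_eq_square sum_distrib_right del: vector_add_component)
    also have "\<dots> = (\<Sum>q\<in>UNIV. s q * s q * ?f z + 2 * e $ q * s q * ?f z + (e $ q)\<^sup>2 * ?f z)"
      by (simp add: power2_eq_square algebra_simps)
    finally have expand: "(norm (M *v z + c))\<^sup>2 * ?f z
      = (\<Sum>q\<in>UNIV. s q * s q * ?f z + 2 * e $ q * s q * ?f z + (e $ q)\<^sup>2 * ?f z)" .
    have s2: "s q * s q * ?f z
        = (\<Sum>a\<in>UNIV. \<Sum>b\<in>UNIV. M $ q $ a * M $ q $ b * (?f z * ((z - m) $ a * (z - m) $ b)))" for q
      unfolding s_def sum_product unfolding sum_distrib_right by (intro sum.cong refl) (simp only: mult_ac)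
    have s1: "2 * e $ q * s q * ?f z = (\<Sum>a\<in>UNIV. 2 * e $ q * M $ q $ a * (?f z * (z - m) $ a))" for q
      unfolding s_def sum_distrib_right sum_distrib_left by (intro sum.cong refl) (simp only: mult_ac)
    show ?thesis unfolding expand s1 s2 ..
  qed
  moreover have "(\<Sum>q\<in>UNIV. (\<Sum>a\<in>UNIV. \<Sum>b\<in>UNIV. M $ q $ a * M $ q $ b * K $ a $ b)
        + (\<Sum>a\<in>UNIV. 2 * e $ q * M $ q $ a * 0) + (e $ q)\<^sup>2 * 1)
      = trace (M ** K ** transpose M) + (norm e)\<^sup>2"
  proof -
    have "(M ** K ** transpose M) $ q $ q = (\<Sum>a\<in>UNIV. \<Sum>b\<in>UNIV. M $ q $ a * M $ q $ b * K $ a $ b)" for q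
      by (subst sum.swap) (simp add: matrix_matrix_mult_def transpose_def sum_distrib_right sum_distrib_left mult_ac)
    then have "trace (M ** K ** transpose M) = (\<Sum>q\<in>UNIV. \<Sum>a\<in>UNIV. \<Sum>b\<in>UNIV. M $ q $ a * M $ q $ b * K $ a $ b)"
      by (simp add: trace_def)
    moreover have "(norm e)\<^sup>2 = (\<Sum>q\<in>UNIV. (e $ q)\<^sup>2)"
      unfolding power2_norm_eq_inner inner_vec_def by (simp add: power2_eq_square)
    ultimately show ?thesis by (simp add: sum.distrib)
  qed
  ultimately show ?thesis by (simp add: e_def)
qed

subsection \<open>Block matrices and conditioning\<close>

lemma stack_nth [simp]: "stack u v $ Inl i = u $ i" "stack u v $ Inr j = v $ j"
  by (simp_all add: stack_def)

lemma upper_stack [simp]: "upper (stack u v) = u"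
  and lower_stack [simp]: "lower (stack u v) = v"
  by (simp_all add: upper_def lower_def vec_eq_iff)

lemma vec_eq_Plus_iff: "x = y \<longleftrightarrow> (\<forall>i. x $ Inl i = y $ Inl i) \<and> (\<forall>j. x $ Inr j = y $ Inr j)"
  by (simp add: vec_eq_iff split_sum_all)

lemma stack_upper_lower [simp]: "stack (upper z) (lower z) = z"
  by (simp add: vec_eq_Plus_iff upper_def lower_def)

lemma sum_UNIV_Plus:
  fixes f :: "'n::finite + 'p::finite \<Rightarrow> 'b::comm_monoid_add"
  shows "(\<Sum>k\<in>UNIV. f k) = (\<Sum>i\<in>UNIV. f (Inl i)) + (\<Sum>j\<in>UNIV. f (Inr j))"
  by (simp flip: UNIV_Plus_UNIV add: sum.Plus)

lemma prod_UNIV_Plus: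
  fixes f :: "'n::finite + 'p::finite \<Rightarrow> 'b::comm_monoid_mult"
  shows "(\<Prod>k\<in>UNIV. f k) = (\<Prod>i\<in>UNIV. f (Inl i)) * (\<Prod>j\<in>UNIV. f (Inr j))"
  by (simp flip: UNIV_Plus_UNIV add: prod.Plus)

lemma inner_stack: "stack a b \<bullet> stack c d = a \<bullet> c + b \<bullet> (d :: real^'p)"
  by (simp add: inner_vec_def sum_UNIV_Plus)

lemma stack_arith:
  fixes a c :: "real^'n" and b d :: "real^'p"
  shows "stack a b + stack c d = stack (a + c) (b + d)"
    and "stack a b - stack c d = stack (a - c) (b - d)"
    and "r *\<^sub>R stack a b = stack (r *\<^sub>R a) (r *\<^sub>R b)"
    and "stack a b = 0 \<longleftrightarrow> a = 0 \<and> b = 0"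
  by (simp_all add: vec_eq_Plus_iff) (auto simp: vec_eq_iff)

lemma upper_lower_arith:
  fixes x y :: "real^('n::finite + 'p::finite)"
  shows "upper (x - y) = upper x - upper y" "lower (x - y) = lower x - lower y"
    "upper (x + y) = upper x + upper y" "lower (x + y) = lower x + lower y"
    "upper (r *\<^sub>R x) = r *\<^sub>R upper x" "lower (r *\<^sub>R x) = r *\<^sub>R lower x"
  by (simp_all add: upper_def lower_def vec_eq_iff)

lemma linear_upper: "linear (upper :: real^('n::finite + 'p::finite) \<Rightarrow> real^'n)"
  and linear_lower: "linear (lower :: real^('n::finite + 'p::finite) \<Rightarrow> real^'p)"
  by (auto intro!: linearI simp: upper_lower_arith)

lemma upper_measurable [measurable]: "(upper :: real^('n::finite + 'p::finite) \<Rightarrow> real^'n) \<in> borel_measurable borel"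
  and lower_measurable [measurable]: "(lower :: real^('n::finite + 'p::finite) \<Rightarrow> real^'p) \<in> borel_measurable borel"
  by (rule borel_measurable_linear linear_upper linear_lower)+

lemma stack_matrix_vector_mult:
  fixes A :: "real^'k^'n" and B :: "real^'k^'p"
  shows "stack A B *v x = stack (A *v x) (B *v x)"
  by (simp add: vec_eq_Plus_iff matrix_vector_mult_def)

text \<open>A box of the joint space is a product of boxes, and box volumes characterise
  \<open>lborel\<close>. The identity serves to carry null sets over to the space of
  observations.\<close>

lemma lborel_stack:
  "distr (lborel \<Otimes>\<^sub>M lborel) borel (\<lambda>(x, y). stack x y) = (lborel :: (real^('n::finite + 'p::finite)) measure)"
proof (rule sym, rule lborel_eqI)
  let ?f = "\<lambda>(x :: real^'n, y :: real^'p). stack x y"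
  have "linear ?f" by (auto intro!: linearI simp: stack_arith)
  then have [measurable]: "?f \<in> borel_measurable (borel \<Otimes>\<^sub>M borel)"
    using borel_measurable_linear[of ?f] by (simp add: borel_prod)
  fix l u :: "real^('n::finite + 'p::finite)" assume "\<And>b. b \<in> Basis \<Longrightarrow> l \<bullet> b \<le> u \<bullet> b"
  then have lu: "l $ k \<le> u $ k" for k
    by (metis axis_in_Basis_iff cart_eq_inner_axis Basis_real_def insertI1)
  have box: "?f -` box l u = box (upper l) (upper u) \<times> box (lower l) (lower u)"
    by (auto simp: mem_box_cart upper_def lower_def split_sum_all)
  have "emeasure (distr (lborel \<Otimes>\<^sub>M lborel) borel ?f) (box l u)
      = emeasure (lborel \<Otimes>\<^sub>M lborel) (box (upper l) (upper u) \<times> box (lower l) (lower u))"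
    by (subst emeasure_distr) (simp_all add: box space_pair_measure)
  also have "\<dots> = emeasure lborel (box (upper l) (upper u)) * emeasure lborel (box (lower l) (lower u))"
    by (rule lborel.emeasure_pair_measure_Times) auto
  also have "\<dots> = ennreal (\<Prod>i\<in>UNIV. u $ Inl i - l $ Inl i) * ennreal (\<Prod>j\<in>UNIV. u $ Inr j - l $ Inr j)"
  proof -
    have "upper l \<bullet> b \<le> upper u \<bullet> b" if "b \<in> Basis" for b
      using that lu by (auto simp: Basis_vec_def inner_axis upper_def)
    moreover have "lower l \<bullet> b \<le> lower u \<bullet> b" if "b \<in> Basis" for b
      using that lu by (auto simp: Basis_vec_def inner_axis lower_def)
    ultimately show ?thesis
      by (simp add: emeasure_lborel_box prod_Basis_vec inner_axis upper_def lower_def)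
  qed
  also have "\<dots> = (\<Prod>b\<in>Basis. (u - l) \<bullet> b)"
    using lu by (simp add: prod_Basis_vec inner_axis prod_UNIV_Plus prod_nonneg flip: ennreal_mult)
  finally show "emeasure (distr (lborel \<Otimes>\<^sub>M lborel) borel ?f) (box l u) = (\<Prod>b\<in>Basis. (u - l) \<bullet> b)" .
qed simp

text \<open>The exceptional set upstairs is a cylinder, whose measure is infinity times that of its
  base; it is null only if the base is.\<close>

lemma AE_lborel_lower:
  fixes P :: "real^'p \<Rightarrow> bool"
  assumes [measurable]: "Measurable.pred borel P"
    and ae: "AE z :: real^('n::finite + 'p::finite) in lborel. P (lower z)"
  shows "AE y in lborel. P y"
proof -
  let ?f = "\<lambda>(x :: real^'n, y :: real^'p). stack x y"
  have "linear ?f" by (auto intro!: linearI simp: stack_arith)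
  then have [measurable]: "?f \<in> borel_measurable (borel \<Otimes>\<^sub>M borel)"
    using borel_measurable_linear[of ?f] by (simp add: borel_prod)
  let ?N = "{y. \<not> P y}"
  have "0 = emeasure lborel {z :: real^('n::finite + 'p::finite). \<not> P (lower z)}"
    using ae by (subst (asm) AE_iff_measurable[OF _ refl]) auto
  also have "\<dots> = emeasure (lborel \<Otimes>\<^sub>M lborel) ((UNIV :: (real^'n) set) \<times> ?N)"
    by (subst lborel_stack[symmetric], subst emeasure_distr)
      (auto intro!: arg_cong2[where f = emeasure] simp: space_pair_measure)
  also have "\<dots> = emeasure lborel (UNIV :: (real^'n) set) * emeasure lborel ?N"
    by (rule lborel.emeasure_pair_measure_Times) auto
  finally have "emeasure lborel ?N = 0"
    by (auto simp: ennreal_top_mult split: if_splits)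
  then show ?thesis by (simp add: AE_iff_measurable[of ?N])
qed

text \<open>A symmetric block matrix in terms of the Schur complement \<open>S\<close> of its lower
  block \<open>R\<close> and of the regression matrix \<open>G\<close>.\<close>

definition schur_block :: "real^'n^'n \<Rightarrow> real^'p^'n \<Rightarrow> real^'p^'p \<Rightarrow> real^('n::finite + 'p::finite)^('n::finite + 'p::finite)" where
  "schur_block S G R = (\<chi> k l. case k of
      Inl i \<Rightarrow> (case l of Inl i' \<Rightarrow> (S + G ** R ** transpose G) $ i $ i' | Inr j \<Rightarrow> (G ** R) $ i $ j)
    | Inr j \<Rightarrow> (case l of Inl i \<Rightarrow> (R ** transpose G) $ j $ i | Inr j' \<Rightarrow> R $ j $ j'))"

lemma schur_block_nth [simp]:
  "schur_block S G R $ Inl i $ Inl i' = (S + G ** R ** transpose G) $ i $ i'"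
  "schur_block S G R $ Inl i $ Inr j = (G ** R) $ i $ j"
  "schur_block S G R $ Inr j $ Inl i = (R ** transpose G) $ j $ i"
  "schur_block S G R $ Inr j $ Inr j' = R $ j $ j'"
  by (simp_all add: schur_block_def)

text \<open>This is the block triangular factorisation in operator form: shear by
  \<open>transpose G\<close>, apply \<open>S\<close> and \<open>R\<close> separately, shear back by
  \<open>G\<close>. Definiteness and inversion thereby reduce to \<open>S\<close> and
  \<open>R\<close>.\<close>

lemma schur_block_mult_stack:
  "schur_block S G R *v stack a b
    = stack (S *v a + G *v (R *v (transpose G *v a + b))) (R *v (transpose G *v a + b))"
proof -
  have "schur_block S G R *v stack a b
      = stack ((S + G ** R ** transpose G) *v a + (G ** R) *v b) ((R ** transpose G) *v a + R *v b)"
    by (simp add: vec_eq_Plus_iff matrix_vector_mult_def sum_UNIV_Plus)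
  then show ?thesis
    by (simp add: algebra_simps flip: matrix_vector_mul_assoc)
qed

lemma pos_def_schur_block:
  assumes "pos_def_matrix S" "pos_def_matrix R"
  shows "pos_def_matrix (schur_block S G R)"
  unfolding pos_def_matrix_def
proof (intro conjI allI impI)
  have "transpose (S + G ** R ** transpose G) = S + G ** R ** transpose G"
    using assms by (simp add: transpose_add matrix_transpose_mul pos_def_matrix_sym matrix_mul_assoc)
  moreover have "transpose (G ** R) = R ** transpose G"
    using assms by (simp add: matrix_transpose_mul pos_def_matrix_sym)
  moreover have "transpose R = R" using assms by (simp add: pos_def_matrix_sym)
  ultimately show "transpose (schur_block S G R) = schur_block S G R"
    by (auto simp: vec_eq_Plus_iff transpose_def vec_eq_iff)
  fix z :: "real^('a::finite + 'b::finite)" assume z: "z \<noteq> 0"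
  define a b where "a = upper z" and "b = lower z"
  let ?w = "transpose G *v a + b"
  have zs: "z = stack a b" by (simp add: a_def b_def)
  have "z \<bullet> (schur_block S G R *v z) = a \<bullet> (S *v a) + ?w \<bullet> (R *v ?w)"
    by (simp add: zs schur_block_mult_stack inner_stack inner_add_right inner_add_left
        inner_matrix_transpose[of a G])
  moreover have "a \<noteq> 0 \<or> ?w \<noteq> 0"
    using z by (auto simp: zs stack_arith)
  ultimately show "0 < z \<bullet> (schur_block S G R *v z)"
    using assms unfolding pos_def_matrix_def
    by (cases "a = 0"; cases "?w = 0") (auto simp: add_pos_pos)
qed

lemma pos_def_schur_blockD:
  assumes "pos_def_matrix (schur_block S G R)" "transpose S = S"
  shows "pos_def_matrix S" "pos_def_matrix R"
proof -
  let ?K = "schur_block S G R"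
  have K: "transpose ?K = ?K" "\<And>z. z \<noteq> 0 \<Longrightarrow> 0 < z \<bullet> (?K *v z)"
    using assms by (auto simp: pos_def_matrix_def)
  show "pos_def_matrix S" unfolding pos_def_matrix_def
  proof (intro conjI allI impI)
    fix x :: "real^'a" assume "x \<noteq> 0"
    \<comment> \<open>The lower component is chosen to cancel the argument of \<open>R\<close>, so
      that only the form of \<open>S\<close> survives.\<close>
    then show "0 < x \<bullet> (S *v x)"
      using K(2)[of "stack x (- (transpose G *v x))"]
      by (simp add: schur_block_mult_stack inner_stack stack_arith)
  qed (fact assms(2))
  show "pos_def_matrix R" unfolding pos_def_matrix_def
  proof (intro conjI allI impI)
    have "transpose ?K $ Inr j $ Inr j' = ?K $ Inr j $ Inr j'" for j j' by (simp add: K)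
    then show "transpose R = R" by (simp add: vec_eq_iff transpose_def)
    fix x :: "real^'b" assume "x \<noteq> 0"
    then show "0 < x \<bullet> (R *v x)"
      using K(2)[of "stack 0 x"] by (simp add: schur_block_mult_stack inner_stack stack_arith)
  qed
qed

text \<open>The exponent splits into a conditional and a marginal part. The constant in
  \<open>c\<close> stays a quotient of the two normalisations, so no determinant of a block matrix
  is computed.\<close>

lemma gaussian_density_schur_block:
  fixes S :: "real^'n::finite^'n" and R :: "real^'p::finite^'p"
  assumes S: "pos_def_matrix S" and R: "pos_def_matrix R"
  obtains c where "\<And>y. 0 < c y"
    "\<And>x y. gaussian_density (stack m1 m2) (schur_block S G R) (stack x y)
      = c y * gaussian_density (m1 + G *v (y - m2)) S x"
proof -
  let ?K = "schur_block S G R"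
  have K: "pos_def_matrix ?K" using pos_def_schur_block[OF S R] .
  note inv = pos_def_matrix_invertible[OF K] pos_def_matrix_invertible[OF S] pos_def_matrix_invertible[OF R]
  define c where "c y = exp (- (1/2) * ((y - m2) \<bullet> (matrix_inv R *v (y - m2))))
      * sqrt ((2 * pi) ^ CARD('n) * det S) / sqrt ((2 * pi) ^ CARD('n + 'p) * det ?K)" for y
  show ?thesis
  proof
    show "0 < c y" for y by (simp add: c_def pos_def_matrix_det K S)
    fix x y
    define w u where "w = y - m2" and "u = x - (m1 + G *v w)"
    \<comment> \<open>The solution of \<open>?K *v k = stack (u + G *v w) w\<close>, found by back
      substitution in the triangular factorisation.\<close>
    let ?k = "stack (matrix_inv S *v u) (matrix_inv R *v w - transpose G *v (matrix_inv S *v u))"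
    have z: "stack x y - stack m1 m2 = stack (u + G *v w) w"
      by (simp add: stack_arith u_def w_def)
    have "?K *v ?k = stack (u + G *v w) w"
      by (simp add: schur_block_mult_stack matrix_vector_mul_assoc matrix_inv_right inv)
    then have "matrix_inv ?K *v stack (u + G *v w) w = (matrix_inv ?K ** ?K) *v ?k"
      by (simp flip: matrix_vector_mul_assoc)
    then have "matrix_inv ?K *v stack (u + G *v w) w = ?k"
      by (simp add: matrix_inv_left inv)
    then have "stack (u + G *v w) w \<bullet> (matrix_inv ?K *v stack (u + G *v w) w)
        = u \<bullet> (matrix_inv S *v u) + w \<bullet> (matrix_inv R *v w)"
      by (simp add: inner_stack inner_add_left inner_diff_right inner_matrix_transpose[of w "transpose G"])
    moreover have "exp (- (1/2) * (a + b)) = exp (- (1/2) * a) * exp (- (1/2) * b)" for a b :: real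
      by (simp only: distrib_left exp_add)
    moreover have "sqrt ((2 * pi) ^ CARD('n) * det S) \<noteq> 0"
      using pos_def_matrix_det[OF S] by simp
    ultimately show "gaussian_density (stack m1 m2) ?K (stack x y)
        = c y * gaussian_density (m1 + G *v (y - m2)) S x"
      unfolding gaussian_density_def z c_def u_def[symmetric] w_def[symmetric] by simp
  qed
qed

lemma cond_density_schur_block:
  assumes S: "pos_def_matrix S" and R: "pos_def_matrix R"
  shows "cond_density (gaussian_density (stack m1 m2) (schur_block S G R)) y
    = gaussian_density (m1 + G *v (y - m2)) S"
proof -
  obtain c where c: "\<And>y. 0 < c y"
    "\<And>x y. gaussian_density (stack m1 m2) (schur_block S G R) (stack x y)
      = c y * gaussian_density (m1 + G *v (y - m2)) S x"
    using gaussian_density_schur_block[OF S R] by blast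
  have "(\<integral>x. gaussian_density (m1 + G *v (y - m2)) S x \<partial>lborel) = 1"
    using gaussian_moments(1)[OF S] by (simp add: has_bochner_integral_iff)
  then show ?thesis
    using c(1)[of y] by (simp add: cond_density_def fun_eq_iff c(2))
qed

text \<open>The map \<open>(x, y) \<mapsto> (2 (m1 + G (y - m2)) - x, y)\<close> preserves Lebesgue measure and the Gaussian
  density, and it changes the sign of the estimation error.\<close>

lemma gaussian_estimation_error_orthogonal:
  fixes G :: "real^'p^'n" and h :: "real^'p \<Rightarrow> real^'n"
    and m1 :: "real^'n::finite" and m2 :: "real^'p::finite"
  assumes S: "pos_def_matrix S" and R: "pos_def_matrix R" and [measurable]: "h \<in> borel_measurable borel"
  defines "f \<equiv> gaussian_density (stack m1 m2) (schur_block S G R)"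
  shows "(\<integral>z. (upper z - (m1 + G *v (lower z - m2))) \<bullet> h (lower z) * f z \<partial>lborel) = 0"
proof -
  obtain c where c: "\<And>x y. f (stack x y) = c y * gaussian_density (m1 + G *v (y - m2)) S x"
    using gaussian_density_schur_block[OF S R] unfolding f_def by metis
  \<comment> \<open>\<open>T\<close> is the linear part of the affine reflection and
    \<open>b\<close>, defined below, its translation part; each preserves \<open>lborel\<close> for
    its own reason.\<close>
  define T :: "real^('n::finite + 'p::finite) \<Rightarrow> real^('n::finite + 'p::finite)"
    where "T z = stack (2 *\<^sub>R (G *v lower z) - upper z) (lower z)" for z
  have T: "linear T"
    by (rule linearI) (simp_all add: T_def stack_arith upper_lower_arith algebra_simps matrix_vector_mult_scaleR)
  have TT: "T (T z) = z" for z by (simp add: T_def)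
  note [measurable] = borel_measurable_linear[OF T]
  have [measurable]: "f \<in> borel_measurable borel" by (simp add: f_def)
  define b where "b = 2 *\<^sub>R stack (m1 - G *v m2) (0 :: real^'p)"
  define F where "F z = (upper z - (m1 + G *v (lower z - m2))) \<bullet> h (lower z) * f z" for z
  have [measurable]: "F \<in> borel_measurable borel" unfolding F_def by measurable
  have up: "upper (b + T z) = 2 *\<^sub>R (m1 + G *v (lower z - m2)) - upper z"
    and low: "lower (b + T z) = lower z" for z
    by (simp_all add: b_def T_def upper_lower_arith algebra_simps matrix_vector_mult_diff_distrib)
  have "f (b + T z) = f z" for z
  proof -
    have "f (b + T z) = f (stack (upper (b + T z)) (lower (b + T z)))" by simp
    also have "\<dots> = f (stack (upper z) (lower z))"
      unfolding up low c
      by (simp add: gaussian_density_def matrix_vector_mult_diff_distrib scaleR_2 inner_diff_left inner_diff_right algebra_simps)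
    finally show ?thesis by simp
  qed
  then have neg: "F (b + T z) = - F z" for z
    unfolding F_def up low by (simp add: inner_diff_left scaleR_2 algebra_simps)
  have "(\<integral>z. F z \<partial>lborel) = (\<integral>z. F (b + z) \<partial>lborel)"
    by (subst lborel_distr_plus[of b, symmetric], subst integral_distr) auto
  also have "\<dots> = (\<integral>z. F (b + T z) \<partial>lborel)"
    by (subst lborel_involution_invariant[OF T TT, symmetric], subst integral_distr) auto
  \<comment> \<open>If \<open>F\<close> is not integrable, both sides are the default value 0, so
    the identity holds unconditionally.\<close>
  also have "\<dots> = - (\<integral>z. F z \<partial>lborel)" by (simp add: neg)
  finally show ?thesis by (simp add: F_def)
qed

subsection \<open>The divergence in terms of eigenvalues\<close>

text \<open>The covariance part of the divergence is the trace of this function of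
  \<open>L\<^sup>-\<^sup>1 K (L\<^sup>-\<^sup>1)\<^sup>T\<close>, for each of the three ranges of \<open>\<tau>\<close>.\<close>

definition tau_entropy :: "real \<Rightarrow> real \<Rightarrow> real" where
  "tau_entropy \<tau> x = (if \<tau> = 0 then - ln x + x - 1
     else if \<tau> < 1 then - (x powr \<tau>) / (\<tau> * (1 - \<tau>)) + x / (1 - \<tau>) + 1 / \<tau>
     else x * ln x - x + 1)"

text \<open>The stationary point in \<open>x\<close> of
  \<open>n * x - tau_entropy \<tau> x / \<theta>\<close>: it solves the equation between the
  derivative of \<open>tau_entropy \<tau>\<close> and \<open>\<theta> * n\<close>. It is the
  function \<psi> of the overview.\<close>

definition tilt :: "real \<Rightarrow> real \<Rightarrow> real \<Rightarrow> real" where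
  "tilt \<tau> \<theta> n = (if \<tau> < 1 then (1 - \<theta> * (1 - \<tau>) * n) powr (1 / (\<tau> - 1)) else exp (\<theta> * n))"

lemma tilt_0 [simp]: "tilt \<tau> \<theta> 0 = 1"
  by (simp add: tilt_def)

lemma tilt_pos: "(\<tau> < 1 \<Longrightarrow> \<theta> * (1 - \<tau>) * n < 1) \<Longrightarrow> 0 < tilt \<tau> \<theta> n"
  by (auto simp: tilt_def)

lemma ln_less_minus_one: "0 < t \<Longrightarrow> t \<noteq> 1 \<Longrightarrow> ln t < t - (1 :: real)"
  using ln_le_minus_one[of t] ln_eq_minus_one[of t] by linarith

text \<open>Two instances of the tangent inequality for \<open>exp\<close> at the intermediate point
  \<tau> u, weighted by 1 - \<tau> and \<tau> so that the linear terms cancel.\<close>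

lemma exp_strictly_convex_at_0:
  fixes u :: real
  assumes "u \<noteq> 0" "0 < \<tau>" "\<tau> < 1"
  shows "exp (\<tau> * u) < 1 - \<tau> + \<tau> * exp u"
proof -
  have lt: "1 + v < exp v" if "v \<noteq> 0" for v :: real
    using ln_less_minus_one[of "exp v"] that by simp
  have "exp (\<tau> * u) * (1 + - (\<tau> * u)) < exp (\<tau> * u) * exp (- (\<tau> * u))"
    using assms by (intro mult_strict_left_mono lt) auto
  then have 1: "exp (\<tau> * u) * (1 - \<tau> * u) < 1" by (simp flip: exp_add)
  have "exp (\<tau> * u) * (1 + (1 - \<tau>) * u) < exp (\<tau> * u) * exp ((1 - \<tau>) * u)"
    using assms by (intro mult_strict_left_mono lt) auto
  also have "\<dots> = exp u" by (simp add: algebra_simps flip: exp_add)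
  finally have 2: "exp (\<tau> * u) * (1 + (1 - \<tau>) * u) < exp u" .
  have "(1 - \<tau>) * (exp (\<tau> * u) * (1 - \<tau> * u)) + \<tau> * (exp (\<tau> * u) * (1 + (1 - \<tau>) * u))
      < (1 - \<tau>) * 1 + \<tau> * exp u"
    using assms 1 2 by (intro add_strict_mono mult_strict_left_mono) auto
  then show ?thesis by (simp add: algebra_simps)
qed

text \<open>With \<open>y\<close> the stationary point, each case is a strict one-variable
  inequality in the ratio of \<open>x\<close> and \<open>y\<close>: \<open>ln t < t - 1\<close> at
  \<open>t = x / y\<close> for \<tau> = 0 and at \<open>t = y / x\<close> for \<tau> = 1, and
  convexity of \<open>exp\<close> at \<open>u = ln x - ln y\<close> in between. Strictness later
  yields uniqueness of the least favorable density.\<close>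

lemma tilt_maximizes:
  assumes tau: "0 \<le> \<tau>" "\<tau> \<le> 1" and theta: "0 < \<theta>" and x: "0 < x"
    and n: "\<tau> < 1 \<Longrightarrow> \<theta> * (1 - \<tau>) * n < 1"
    and ne: "x \<noteq> tilt \<tau> \<theta> n"
  shows "n * x - tau_entropy \<tau> x / \<theta> < n * tilt \<tau> \<theta> n - tau_entropy \<tau> (tilt \<tau> \<theta> n) / \<theta>"
proof -
  define y where "y = tilt \<tau> \<theta> n"
  have y: "0 < y" unfolding y_def by (rule tilt_pos[OF n])
  have xy: "x \<noteq> y" using ne by (simp add: y_def)
  have "\<theta> * n * x - tau_entropy \<tau> x < \<theta> * n * y - tau_entropy \<tau> y"
  proof -
    consider "\<tau> = 0" | "0 < \<tau>" "\<tau> < 1" | "\<tau> = 1" using tau by linarith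
    then show ?thesis
    proof cases
      case 1
      define a where "a = 1 - \<theta> * n"
      have a: "0 < a" using n 1 by (simp add: a_def)
      have ya: "y = 1 / a" using a 1 by (simp add: y_def tilt_def a_def powr_minus_divide)
      have "ln (a * x) < a * x - 1"
        using a x xy by (intro ln_less_minus_one) (auto simp: ya field_simps)
      then have "ln x + ln a < a * x - 1" using a x by (simp add: ln_mult)
      moreover have "\<theta> * n = 1 - a" by (simp add: a_def)
      then have "\<theta> * n * z = z - a * z" for z by (simp only: left_diff_distrib mult_1)
      moreover have "a * y = 1" "ln y = - ln a" using a by (simp_all add: ya ln_div)
      ultimately show ?thesis using 1 by (simp add: tau_entropy_def)
    next
      case 2
      define a where "a = 1 - \<theta> * (1 - \<tau>) * n"
      have a: "0 < a" using n 2 by (simp add: a_def)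
      \<comment> \<open>This is the stationarity equation. Multiplied by \<open>y\<close>, it makes
        \<open>a * y\<close> a common factor of both powers.\<close>
      have "y powr (\<tau> - 1) = a" using a 2 by (simp add: y_def tilt_def a_def powr_powr)
      then have ya: "y powr \<tau> = a * y"
        using y powr_add[of y "\<tau> - 1" 1] by simp
      define u where "u = ln x - ln y"
      have u: "u \<noteq> 0" using xy x y by (simp add: u_def)
      have xe: "x = y * exp u" using x y by (simp add: u_def exp_diff)
      have "x powr \<tau> = y powr \<tau> * exp (\<tau> * u)"
        using x y by (simp add: powr_def u_def right_diff_distrib flip: exp_add)
      then have "x powr \<tau> = a * y * exp (\<tau> * u)" by (simp add: ya)
      moreover have "a * y * exp (\<tau> * u) < a * y * (1 - \<tau> + \<tau> * exp u)"
        using a y u 2 by (intro mult_strict_left_mono exp_strictly_convex_at_0) auto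
      ultimately have "x powr \<tau> < y powr \<tau> - \<tau> * a * y + \<tau> * a * x"
        by (simp add: ya xe algebra_simps)
      then have "(x powr \<tau> - \<tau> * a * x) / (\<tau> * (1 - \<tau>)) < (y powr \<tau> - \<tau> * a * y) / (\<tau> * (1 - \<tau>))"
        using 2 by (intro divide_strict_right_mono) auto
      moreover have "\<theta> * n * z - tau_entropy \<tau> z = (z powr \<tau> - \<tau> * a * z) / (\<tau> * (1 - \<tau>)) - 1 / \<tau>" for z
      proof -
        have "\<theta> * n * z = (z - a * z) / (1 - \<tau>)" using 2 by (simp add: a_def field_simps)
        then show ?thesis
          using 2 by (simp add: tau_entropy_def diff_divide_distrib)
      qed
      ultimately show ?thesis by simp
    next
      case 3
      have "ln (y / x) < y / x - 1"
        using x y xy by (intro ln_less_minus_one) auto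
      then have "x * ln (y / x) < y - x"
        using x by (simp add: field_simps)
      moreover have "ln y = \<theta> * n" using 3 by (simp add: y_def tilt_def)
      ultimately show ?thesis
        using 3 x y by (simp add: tau_entropy_def ln_div algebra_simps)
    qed
  qed
  then have "(\<theta> * n * x - tau_entropy \<tau> x) / \<theta> < (\<theta> * n * y - tau_entropy \<tau> y) / \<theta>"
    using theta by (intro divide_strict_right_mono)
  then show ?thesis using theta by (simp add: y_def diff_divide_distrib)
qed

lemma invertible_transpose_eq_0:
  fixes L :: "real^'k^'k"
  assumes "invertible L" "transpose L *v x = 0" shows "x = 0"
proof -
  have "transpose (matrix_inv L) ** transpose L = mat 1"
    using matrix_inv_right[OF assms(1)] by (metis matrix_transpose_mul transpose_mat)
  then show ?thesis using assms(2)
    by (metis matrix_vector_mul_assoc matrix_vector_mul_lid matrix_vector_mult_0_right)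
qed

lemma matrix_inv_unique:
  fixes A B :: "real^'k^'k"
  assumes "A ** B = mat 1" shows "matrix_inv A = B"
proof -
  have "invertible A" using assms by (metis invertible_right_inverse)
  then show ?thesis
    by (metis assms matrix_inv_left matrix_mul_assoc matrix_mul_lid matrix_mul_rid)
qed

text \<open>The factor \<open>L\<close> cancels: the covariance quotient is
  \<open>L ** X ** matrix_inv L\<close>, which is similar to \<open>X\<close>, so trace and
  determinant see only the eigenvalues of \<open>X\<close>; and the quadratic form of the inverse
  covariance at \<open>L *v w\<close> is the squared norm of \<open>w\<close>.\<close>

lemma tau_divergence_gaussian:
  fixes L X :: "real^'k^'k"
  assumes tau: "0 \<le> \<tau>" "\<tau> \<le> 1" and L: "invertible L" and X: "pos_def_matrix X"
  shows "tau_divergence \<tau> L (gaussian_density (m + L *v w) (L ** X ** transpose L))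
      (gaussian_density m (L ** transpose L))
    = (if \<tau> < 1 then ereal ((norm w)\<^sup>2 / (1 - \<tau>) + trace (matrix_fun (tau_entropy \<tau>) X))
       else delta_infty w + ereal (trace (matrix_fun (tau_entropy \<tau>) X)))"
proof -
  let ?Li = "matrix_inv L" and ?K = "L ** transpose L" and ?Kt = "L ** X ** transpose L"
  obtain R x where R: "orthogonal_matrix R" "X = R ** diag_matrix x ** transpose R" and x: "\<And>i. 0 < x i"
    using pos_def_matrix_diagonalization[OF X] by blast
  have Li: "?Li ** L = mat 1" "L ** ?Li = mat 1"
    using L by (simp_all add: matrix_inv_left matrix_inv_right)
  have LiT: "transpose L ** transpose ?Li = mat 1" "transpose ?Li ** transpose L = mat 1"
    using Li by (metis matrix_transpose_mul transpose_mat)+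
  have Kt: "pos_def_matrix ?Kt"
    using X invertible_transpose_eq_0[OF L] by (intro pos_def_matrix_congruence)
  have one: "pos_def_matrix (mat 1 :: real^'k^'k)" by (simp add: pos_def_matrix_def)
  have K: "pos_def_matrix ?K"
    using pos_def_matrix_congruence[OF one, of L] invertible_transpose_eq_0[OF L] by simp
  have Ki: "matrix_inv ?K = transpose ?Li ** ?Li"
    by (rule matrix_inv_unique) (metis Li(2) LiT(1) matrix_mul_assoc matrix_mul_lid matrix_mul_rid)
  have X': "?Li ** ?Kt ** transpose ?Li = X"
    by (metis Li(1) LiT(1) matrix_mul_assoc matrix_mul_lid matrix_mul_rid)
  have KtKi: "?Kt ** matrix_inv ?K = L ** (X ** ?Li)"
    unfolding Ki by (metis LiT(1) matrix_mul_assoc matrix_mul_rid)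
  have q: "(L *v w) \<bullet> (matrix_inv ?K *v (L *v w)) = (norm w)\<^sup>2"
  proof -
    have "matrix_inv ?K *v (L *v w) = transpose ?Li *v ((?Li ** L) *v w)"
      unfolding Ki by (simp add: matrix_vector_mul_assoc matrix_mul_assoc)
    then show ?thesis
      by (simp add: Li inner_matrix_transpose[of _ "transpose ?Li"] matrix_vector_mul_assoc
          power2_norm_eq_inner)
  qed
  have Lw: "L *v w = 0 \<longleftrightarrow> w = 0"
    by (metis Li(1) matrix_vector_mul_assoc matrix_vector_mul_lid matrix_vector_mult_0_right)
  have tr: "trace (?Kt ** matrix_inv ?K) = (\<Sum>i\<in>UNIV. x i)"
  proof -
    have "trace (L ** (X ** ?Li)) = trace X"
      by (subst trace_mul_sym) (simp add: Li flip: matrix_mul_assoc)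
    then show ?thesis unfolding KtKi by (simp add: R(2) trace_conjugate_diag[OF R(1)])
  qed
  have det: "det (?Kt ** matrix_inv ?K) = (\<Prod>i\<in>UNIV. x i)"
  proof -
    have "det L * det ?Li = 1" using Li(2) by (metis det_I det_mul)
    then have "det (L ** (X ** ?Li)) = det X" by (simp add: det_mul)
    then show ?thesis unfolding KtKi by (simp add: R(2) det_conjugate_diag[OF R(1)])
  qed
  have trf: "trace (matrix_fun h X) = (\<Sum>i\<in>UNIV. h (x i))" for h
    by (simp add: matrix_fun_eq[OF R] trace_conjugate_diag[OF R(1)])
  have trln: "trace (X ** matrix_fun ln X) = (\<Sum>i\<in>UNIV. x i * ln (x i))"
    by (simp add: matrix_fun_eq[OF R]) (simp add: R(2) conjugate_diag_mult[OF R(1)] trace_conjugate_diag[OF R(1)])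
  consider "\<tau> = 0" | "0 < \<tau>" "\<tau> < 1" | "\<tau> = 1" using tau by linarith
  then show ?thesis
  proof cases
    case 1
    have "ln (\<Prod>i\<in>UNIV. x i) = (\<Sum>i\<in>UNIV. ln (x i))" using x by (intro ln_prod) (auto simp: less_imp_neq[symmetric])
    with 1 show ?thesis
      by (simp add: tau_divergence_def Let_def K Kt q det trace_sub tr trace_I trf tau_entropy_def
          sum.distrib sum_subtractf sum_negf)
  next
    case 2
    then show ?thesis
      by (simp add: tau_divergence_def Let_def K Kt q trace_add trace_sub tr trace_I trf tau_entropy_def
          sum.distrib sum_subtractf sum_negf trace_scaleR sum_divide_distrib X')
  next
    case 3
    then show ?thesis
      by (simp add: tau_divergence_def Let_def K Kt q trace_add trace_sub tr trace_I trf tau_entropy_def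
          sum.distrib sum_subtractf trln X' delta_infty_def Lw)
  qed
qed


text \<open>Pythagoras: the regression error is orthogonal to every function of the observation, so
  any other estimator adds its mean squared distance from the regression. Most of the proof secures
  integrability, without which the integral would not split.\<close>

lemma estimation_error_split:
  fixes S :: "real^'n::finite^'n" and R :: "real^'p::finite^'p" and G :: "real^'p^'n"
    and m1 :: "real^'n" and m2 :: "real^'p" and g :: "real^'p \<Rightarrow> real^'n"
  defines "f \<equiv> gaussian_density (stack m1 m2) (schur_block S G R)"
    and "go \<equiv> (\<lambda>y. m1 + G *v (y - m2))"
  assumes S: "pos_def_matrix S" and R: "pos_def_matrix R" and [measurable]: "g \<in> borel_measurable borel"
    and int: "integrable lborel (\<lambda>z. (norm (g (lower z)))\<^sup>2 * f z)"
  shows "integrable lborel (\<lambda>z. (norm (go (lower z) - g (lower z)))\<^sup>2 * f z)" (is ?int)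
    and "density_expectation f (\<lambda>z. (norm (upper z - g (lower z)))\<^sup>2)
      = density_expectation f (\<lambda>z. (norm (upper z - go (lower z)))\<^sup>2)
        + density_expectation f (\<lambda>z. (norm (go (lower z) - g (lower z)))\<^sup>2)" (is ?eq)
proof -
  have K: "pos_def_matrix (schur_block S G R)" using pos_def_schur_block[OF S R] .
  have fpos: "0 \<le> f z" for z using gaussian_density_pos[OF K] by (simp add: f_def less_imp_le)
  have [measurable]: "f \<in> borel_measurable borel" by (simp add: f_def)
  have go [measurable]: "go \<in> borel_measurable borel" unfolding go_def by measurable
  have second: "integrable lborel (\<lambda>z. (norm (h z))\<^sup>2 * f z)"
    if "\<And>z. h z = l z + c" "linear l" for h l :: "real^('n + 'p) \<Rightarrow> real^'n" and c
    using gaussian_second_moment[OF K, of "matrix l" c "stack m1 m2"] that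
    by (auto simp: f_def matrix_works has_bochner_integral_iff)
  define e where "e z = upper z - go (lower z)" for z
  define d where "d z = go (lower z) - g (lower z)" for z :: "real^('n + 'p)"
  have [measurable]: "e \<in> borel_measurable borel" "d \<in> borel_measurable borel"
    unfolding e_def d_def by measurable
  have e_int: "integrable lborel (\<lambda>z. (norm (e z))\<^sup>2 * f z)"
    by (rule second[where l = "\<lambda>z. upper z - G *v lower z" and c = "- (m1 - G *v m2)"])
      (auto simp: e_def go_def matrix_vector_mult_diff_distrib
        intro!: linearI simp: upper_lower_arith algebra_simps matrix_vector_mult_scaleR)
  have go_int: "integrable lborel (\<lambda>z. (norm (go (lower z)))\<^sup>2 * f z)"
    by (rule second[where l = "\<lambda>z. G *v lower z" and c = "m1 - G *v m2"])
      (auto simp: go_def matrix_vector_mult_diff_distrib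
        intro!: linearI simp: upper_lower_arith algebra_simps matrix_vector_mult_scaleR)
  show d_int: ?int unfolding d_def[symmetric]
  proof (rule Bochner_Integration.integrable_bound)
    show "integrable lborel (\<lambda>z. 2 * ((norm (go (lower z)))\<^sup>2 * f z) + 2 * ((norm (g (lower z)))\<^sup>2 * f z))"
      using go_int int by simp
    have "(norm (a - b))\<^sup>2 \<le> 2 * (norm a)\<^sup>2 + 2 * (norm b)\<^sup>2" for a b :: "real^'n"
      using inner_ge_zero[of "a + b"]
      by (simp add: power2_norm_eq_inner inner_diff_left inner_diff_right inner_add_left inner_add_right inner_commute)
    then have "(norm (d z))\<^sup>2 * f z \<le> (2 * (norm (go (lower z)))\<^sup>2 + 2 * (norm (g (lower z)))\<^sup>2) * f z" for z
      unfolding d_def using fpos by (intro mult_right_mono) auto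
    then show "AE z in lborel. norm ((norm (d z))\<^sup>2 * f z)
        \<le> norm (2 * ((norm (go (lower z)))\<^sup>2 * f z) + 2 * ((norm (g (lower z)))\<^sup>2 * f z))"
      using fpos by (simp add: algebra_simps)
  qed simp
  have cross_int: "integrable lborel (\<lambda>z. (e z \<bullet> d z) * f z)"
  proof (rule Bochner_Integration.integrable_bound)
    show "integrable lborel (\<lambda>z. (norm (e z))\<^sup>2 * f z + (norm (d z))\<^sup>2 * f z)"
      using e_int d_int by (simp add: d_def)
    have "\<bar>a \<bullet> b\<bar> \<le> (norm a)\<^sup>2 + (norm b)\<^sup>2" for a b :: "real^'n"
    proof -
      have "\<bar>a \<bullet> b\<bar> \<le> norm a * norm b" by (rule Cauchy_Schwarz_ineq2)
      also have "2 * (norm a * norm b) \<le> (norm a)\<^sup>2 + (norm b)\<^sup>2"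
        using sum_squares_bound[of "norm a" "norm b"] by simp
      then have "norm a * norm b \<le> (norm a)\<^sup>2 + (norm b)\<^sup>2"
        using mult_nonneg_nonneg[OF norm_ge_zero norm_ge_zero, of a b] by linarith
      finally show ?thesis .
    qed
    then have "\<bar>e z \<bullet> d z\<bar> * f z \<le> ((norm (e z))\<^sup>2 + (norm (d z))\<^sup>2) * f z" for z
      using fpos by (intro mult_right_mono) auto
    then show "AE z in lborel. norm ((e z \<bullet> d z) * f z) \<le> norm ((norm (e z))\<^sup>2 * f z + (norm (d z))\<^sup>2 * f z)"
      using fpos by (simp add: abs_mult distrib_right)
  qed simp
  have "(\<integral>z. (e z \<bullet> d z) * f z \<partial>lborel) = 0"
    using gaussian_estimation_error_orthogonal[OF S R, of "\<lambda>y. go y - g y" m1 G m2]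
    by (simp add: e_def d_def f_def go_def)
  moreover have "(norm (upper z - g (lower z)))\<^sup>2 * f z
      = (norm (e z))\<^sup>2 * f z + 2 * ((e z \<bullet> d z) * f z) + (norm (d z))\<^sup>2 * f z" for z
  proof -
    have "upper z - g (lower z) = e z + d z" by (simp add: e_def d_def)
    then show ?thesis
      by (simp add: power2_norm_eq_inner inner_add_left inner_add_right inner_commute algebra_simps)
  qed
  ultimately show ?eq
    using e_int cross_int d_int by (simp add: density_expectation_def flip: e_def d_def)
qed

subsection \<open>The saddle point\<close>

text \<open>The state-space model enters the minimax problem only through the Schur form of the
  joint covariance; \<open>L\<close> may be any square factor of it.\<close>

locale risk_problem =
  fixes \<tau> \<theta> :: real and P :: "real^'n::finite^'n" and G :: "real^'p::finite^'n" and R :: "real^'p^'p"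
    and L :: "real^('n + 'p)^('n + 'p)" and m1 :: "real^'n" and m2 :: "real^'p"
  assumes tau: "0 \<le> \<tau>" "\<tau> \<le> 1" and theta: "0 < \<theta>"
    and P: "pos_def_matrix P" and R: "pos_def_matrix R"
    and L: "L ** transpose L = schur_block P G R"
    and P_bound: "\<tau> < 1 \<Longrightarrow> matrix_less P (inverse (\<theta> * (1 - \<tau>)) *\<^sub>R mat 1)"
begin

definition "fbar = gaussian_density (stack m1 m2) (schur_block P G R)"
definition "g_opt y = m1 + G *v (y - m2)"
definition M :: "real^('n + 'p)^'n" where "M = matrix (\<lambda>z. upper z - G *v lower z)"
definition "H = M ** L"
definition "X0 = matrix_fun (tilt \<tau> \<theta>) (transpose H ** H)"
text \<open>On an eigenvalue \<open>x\<close> of \<open>P\<close> this is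
  \<open>x * tilt \<tau> \<theta> x\<close>. The additive form is what conjugation by
  \<open>L\<close> produces in the upper block, and it mentions no factor of
  \<open>P\<close>.\<close>

definition "V_lf = P + P ** matrix_fun (\<lambda>x. (tilt \<tau> \<theta> x - 1) / x) P ** P"
definition "f_lf = gaussian_density (stack m1 m2) (schur_block V_lf G R)"

lemma K_pos_def: "pos_def_matrix (schur_block P G R)"
  using pos_def_schur_block[OF P R] .

lemma L_invertible: "invertible L"
  using pos_def_matrix_det[OF K_pos_def] by (auto simp: invertible_det_nz det_mul simp flip: L)

lemma M_mult: "M *v z = upper z - G *v lower z"
proof -
  have "linear (\<lambda>z :: real^('n + 'p). upper z - G *v lower z)"
    by (auto intro!: linearI simp: upper_lower_arith algebra_simps matrix_vector_mult_scaleR)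
  then show ?thesis by (simp add: M_def matrix_works)
qed

lemma transpose_M_mult: "transpose M *v a = stack a (- (transpose G *v a))"
proof -
  have "(transpose M *v a) \<bullet> z = stack a (- (transpose G *v a)) \<bullet> z" for z
  proof -
    have "(transpose M *v a) \<bullet> z = a \<bullet> (upper z - G *v lower z)"
      by (simp add: M_mult flip: inner_matrix_transpose)
    also have "\<dots> = stack a (- (transpose G *v a)) \<bullet> stack (upper z) (lower z)"
      by (simp add: inner_stack inner_diff_right inner_matrix_transpose del: stack_upper_lower)
    finally show ?thesis by simp
  qed
  then show ?thesis by (metis vector_eq_rdot)
qed

text \<open>\<open>L ** transpose H\<close> equals the joint covariance times
  \<open>transpose M\<close>, and \<open>transpose M *v a\<close> is the very vector whose
  \<open>R\<close> part cancels. This vanishing lower component is why tilting affects the block of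
  \<open>x\<close> alone.\<close>

lemma L_transpose_H: "L *v (transpose H *v a) = stack (P *v a) 0"
proof -
  have "L *v (transpose H *v a) = schur_block P G R *v (transpose M *v a)"
    by (simp add: H_def matrix_transpose_mul matrix_vector_mul_assoc flip: L matrix_mul_assoc)
  then show ?thesis by (simp add: transpose_M_mult schur_block_mult_stack)
qed

lemma H_gram: "H ** transpose H = P"
proof -
  have "H ** transpose H *v a = P *v a" for a
  proof -
    have "H ** transpose H *v a = M *v (L *v (transpose H *v a))"
      by (simp add: H_def matrix_vector_mul_assoc matrix_mul_assoc)
    then show ?thesis by (simp add: L_transpose_H M_mult)
  qed
  then show ?thesis by (simp add: matrix_eq)
qed

text \<open>The bound is known for \<open>H ** transpose H\<close>, which is \<open>P\<close>, and
  is wanted for the other Gram matrix. Cauchy-Schwarz transfers it: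
  \<open>p \<bullet> p = r \<bullet> w\<close>, while
  \<open>r \<bullet> r = p \<bullet> (P *v p)\<close> is below
  \<open>c * (p \<bullet> p)\<close>.\<close>

lemma H_bound:
  assumes "\<tau> < 1" "w \<noteq> 0"
  shows "\<theta> * (1 - \<tau>) * (norm (H *v w))\<^sup>2 < (norm w)\<^sup>2"
proof (cases "H *v w = 0")
  case False
  define c where "c = inverse (\<theta> * (1 - \<tau>))"
  define p where "p = H *v w"
  define r where "r = transpose H *v p"
  have c: "0 < c" using assms theta by (simp add: c_def)
  have p0: "p \<noteq> 0" using False by (simp add: p_def)
  have "r \<bullet> r = p \<bullet> (P *v p)"
    unfolding r_def H_gram[symmetric]
    by (simp add: inner_matrix_transpose[of p H] flip: matrix_vector_mul_assoc)
  also have "\<dots> < c * (p \<bullet> p)"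
    using P_bound[OF assms(1), folded c_def] p0 unfolding matrix_less_def pos_def_matrix_def
    by (simp add: matrix_vector_mult_diff_rdistrib inner_diff_right
        flip: scaleR_matrix_vector_assoc)
  finally have "r \<bullet> r < c * (p \<bullet> p)" .
  moreover have "(p \<bullet> p)\<^sup>2 \<le> (r \<bullet> r) * (w \<bullet> w)"
    using Cauchy_Schwarz_ineq[of r w] by (simp add: r_def p_def flip: inner_matrix_transpose)
  moreover have "0 < w \<bullet> w" "0 < p \<bullet> p" using assms p0 by auto
  ultimately have "(p \<bullet> p)\<^sup>2 < (c * (p \<bullet> p)) * (w \<bullet> w)"
    by (meson mult_strict_right_mono order_le_less_trans)
  then have "p \<bullet> p < c * (w \<bullet> w)"
    using \<open>0 < p \<bullet> p\<close> by (simp add: power2_eq_square mult_ac)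
  moreover have "\<theta> * (1 - \<tau>) * c = 1"
    unfolding c_def using assms theta by (intro right_inverse) simp
  ultimately show ?thesis using assms theta
    by (simp add: power2_norm_eq_inner p_def[symmetric] c_def field_simps)
qed (use assms in simp)

text \<open>The eigenvalue is the squared norm of \<open>H *v q\<close> for the unit eigenvector
  \<open>q\<close>, the \<open>i\<close>-th column of \<open>Q\<close>.\<close>

lemma tilt_eigenvalue_bound:
  assumes Q: "orthogonal_matrix Q" "transpose H ** H = Q ** diag_matrix n ** transpose Q" and "\<tau> < 1"
  shows "\<theta> * (1 - \<tau>) * n i < 1"
proof -
  define q where "q = Q *v axis i 1"
  have Qq: "transpose Q *v q = axis i 1"
    using Q(1) unfolding q_def by (metis matrix_vector_mul_assoc matrix_vector_mul_lid orthogonal_matrix_def)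
  have qq: "q \<bullet> q = 1"
    using Qq inner_matrix_transpose[of q Q "axis i 1"] by (simp add: q_def inner_axis_axis)
  have "(H *v q) \<bullet> (H *v q) = q \<bullet> ((transpose H ** H) *v q)"
    by (simp add: inner_matrix_transpose[of q "transpose H"] flip: matrix_vector_mul_assoc)
  also have "\<dots> = axis i 1 \<bullet> (diag_matrix n *v axis i 1)"
    by (simp add: Q(2) Qq inner_matrix_transpose[of q Q] flip: matrix_vector_mul_assoc)
  also have "\<dots> = n i" by (simp add: inner_axis')
  finally have "(norm (H *v q))\<^sup>2 = n i" by (simp add: power2_norm_eq_inner)
  moreover have "q \<noteq> 0" "(norm q)\<^sup>2 = 1" using qq by (auto simp: power2_norm_eq_inner)
  ultimately show ?thesis using H_bound[OF assms(3), of q] by simp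
qed

lemma N_sym: "transpose (transpose H ** H) = transpose H ** H"
  by (simp add: matrix_transpose_mul)

lemma X0_pos_def: "pos_def_matrix X0"
proof -
  obtain Q n where Q: "orthogonal_matrix Q" "transpose H ** H = Q ** diag_matrix n ** transpose Q"
    using symmetric_matrix_diagonalization[OF N_sym] .
  show ?thesis
    unfolding X0_def matrix_fun_eq[OF Q]
    by (intro pos_def_matrix_conjugate_diag Q(1) tilt_pos tilt_eigenvalue_bound[OF Q])
qed

text \<open>\<open>X0 - mat 1\<close> is sandwiched between \<open>transpose H\<close> and
  \<open>H\<close>. On the right \<open>H *v (transpose L *v z)\<close> depends only on the upper
  part of \<open>z\<close>; on the left the output has no lower part.\<close>

lemma X0_covariance: "L ** X0 ** transpose L = schur_block V_lf G R"
proof -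
  let ?C = "matrix_fun (\<lambda>x. (tilt \<tau> \<theta> x - 1) / x) P"
  have X0: "X0 = mat 1 + transpose H ** ?C ** H"
    unfolding X0_def by (subst matrix_fun_gram) (simp_all add: H_gram)
  have "(L ** X0 ** transpose L) *v z = schur_block V_lf G R *v z" for z
  proof -
    obtain a b where z: "z = stack a b" by (metis stack_upper_lower)
    let ?t = "transpose G *v a + b"
    have HL: "H *v (transpose L *v z) = P *v a"
    proof -
      have "H *v (transpose L *v z) = M *v ((L ** transpose L) *v z)"
        by (simp add: H_def matrix_vector_mul_assoc matrix_mul_assoc)
      then show ?thesis by (simp add: L z schur_block_mult_stack M_mult)
    qed
    have "(L ** X0 ** transpose L) *v z
        = (L ** transpose L) *v z + L *v (transpose H *v (?C *v (H *v (transpose L *v z))))"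
      by (simp add: X0 matrix_add_ldistrib matrix_add_rdistrib matrix_vector_mult_add_rdistrib
          matrix_vector_mul_assoc matrix_mul_assoc)
    also have "\<dots> = stack (P *v a + G *v (R *v ?t) + P *v (?C *v (P *v a))) (R *v ?t)"
      unfolding HL L_transpose_H by (simp add: L z schur_block_mult_stack stack_arith)
    also have "\<dots> = schur_block V_lf G R *v z"
      by (simp add: z schur_block_mult_stack V_lf_def matrix_vector_mult_add_rdistrib add_ac
          flip: matrix_vector_mul_assoc)
    finally show ?thesis .
  qed
  then show ?thesis by (simp add: matrix_eq)
qed

text \<open>Obtained backwards, as the Schur complement of the covariance
  \<open>L ** X0 ** transpose L\<close>, whose definiteness is already known.\<close>

lemma V_lf_pos_def: "pos_def_matrix V_lf"
proof (rule pos_def_schur_blockD(1))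
  show "pos_def_matrix (schur_block V_lf G R)"
    unfolding X0_covariance[symmetric]
    using X0_pos_def invertible_transpose_eq_0[OF L_invertible] by (intro pos_def_matrix_congruence)
  show "transpose V_lf = V_lf"
    using P by (simp add: V_lf_def transpose_add matrix_transpose_mul transpose_matrix_fun
        pos_def_matrix_sym matrix_mul_assoc)
qed

text \<open>The objective at \<open>g_opt\<close> for an unshifted mean, as a function of the
  whitened covariance.\<close>

definition "gain X = trace (H ** X ** transpose H) - trace (matrix_fun (tau_entropy \<tau>) X) / \<theta>"

lemma gain_less:
  assumes X: "pos_def_matrix X" "X \<noteq> X0"
  shows "gain X < gain X0"
proof -
  obtain Q n where Q: "orthogonal_matrix Q" "transpose H ** H = Q ** diag_matrix n ** transpose Q"
    using symmetric_matrix_diagonalization[OF N_sym] .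
  obtain U x where U: "orthogonal_matrix U" "X = U ** diag_matrix x ** transpose U" and x: "\<And>i. 0 < x i"
    using pos_def_matrix_diagonalization[OF X(1)] by blast
  let ?y = "\<lambda>i. tilt \<tau> \<theta> (n i)"
  have X0: "X0 = Q ** diag_matrix ?y ** transpose Q"
    unfolding X0_def by (rule matrix_fun_eq[OF Q])
  have gain: "gain Y = trace ((transpose H ** H) ** Y) - trace (matrix_fun (tau_entropy \<tau>) Y) / \<theta>" for Y
    unfolding gain_def
    by (simp add: trace_mul_sym[of "H ** Y" "transpose H"] matrix_mul_assoc)
  have "gain X = trace ((Q ** diag_matrix n ** transpose Q) ** (U ** diag_matrix x ** transpose U))
      - (\<Sum>j\<in>UNIV. tau_entropy \<tau> (x j) / \<theta>)"
    unfolding gain Q(2) matrix_fun_eq[OF U] trace_conjugate_diag[OF U(1)]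
    by (simp add: U(2) sum_divide_distrib)
  also have "\<dots> < (\<Sum>i\<in>UNIV. n i * ?y i - tau_entropy \<tau> (?y i) / \<theta>)"
  proof (rule trace_variational_strict[OF Q(1) U(1)])
    show "U ** diag_matrix x ** transpose U \<noteq> Q ** diag_matrix ?y ** transpose Q"
      using X(2) U(2) X0 by simp
  qed (intro tilt_maximizes tau theta x tilt_eigenvalue_bound[OF Q])
  also have "\<dots> = gain X0"
    unfolding gain matrix_fun_eq[OF Q(1) X0] trace_conjugate_diag[OF Q(1)] Q(2)
    by (simp add: X0 conjugate_diag_mult[OF Q(1)] trace_conjugate_diag[OF Q(1)] sum_subtractf sum_divide_distrib)
  finally show ?thesis .
qed

lemma tau_divergence_fbar:
  assumes "pos_def_matrix X"
  shows "tau_divergence \<tau> L (gaussian_density (stack m1 m2 + L *v w) (L ** X ** transpose L)) fbar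
    = (if \<tau> < 1 then ereal ((norm w)\<^sup>2 / (1 - \<tau>) + trace (matrix_fun (tau_entropy \<tau>) X))
       else delta_infty w + ereal (trace (matrix_fun (tau_entropy \<tau>) X)))"
  unfolding fbar_def L[symmetric] by (rule tau_divergence_gaussian[OF tau L_invertible assms])

lemma pos_def_factor_through_L:
  assumes "pos_def_matrix K"
  obtains X where "pos_def_matrix X" "K = L ** X ** transpose L"
proof
  let ?Li = "matrix_inv L"
  have Li: "?Li ** L = mat 1" "L ** ?Li = mat 1"
    using L_invertible by (simp_all add: matrix_inv_left matrix_inv_right)
  have LiT: "transpose ?Li ** transpose L = mat 1"
    using Li by (metis matrix_transpose_mul transpose_mat)
  have "invertible ?Li" using Li by (metis invertible_right_inverse)
  then show "pos_def_matrix (?Li ** K ** transpose ?Li)"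
    using assms invertible_transpose_eq_0 by (intro pos_def_matrix_congruence)
  show "K = L ** (?Li ** K ** transpose ?Li) ** transpose L"
    by (metis Li(2) LiT matrix_mul_assoc matrix_mul_lid matrix_mul_rid)
qed

text \<open>Invertibility of \<open>L\<close> gives every nondegenerate Gaussian density such
  coordinates. Finite divergence restricts them only at \<tau> = 1, where \<open>delta_infty\<close>
  pins the mean.\<close>

lemma ambiguity_set_iff:
  "f \<in> ambiguity_set \<tau> L fbar \<longleftrightarrow> (\<exists>X w. pos_def_matrix X \<and> (\<tau> = 1 \<longrightarrow> w = 0)
    \<and> f = gaussian_density (stack m1 m2 + L *v w) (L ** X ** transpose L))" (is "_ \<longleftrightarrow> ?r")
proof
  assume "f \<in> ambiguity_set \<tau> L fbar"
  then obtain m K where K: "pos_def_matrix K" "f = gaussian_density m K"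
    and fin: "tau_divergence \<tau> L f fbar < \<infinity>" by (auto simp: ambiguity_set_def)
  obtain X where X: "pos_def_matrix X" "K = L ** X ** transpose L"
    using pos_def_factor_through_L[OF K(1)] .
  define w where "w = matrix_inv L *v (m - stack m1 m2)"
  have "L *v w = m - stack m1 m2"
    by (simp add: w_def matrix_vector_mul_assoc matrix_inv_right[OF L_invertible])
  then have f: "f = gaussian_density (stack m1 m2 + L *v w) (L ** X ** transpose L)"
    by (simp add: K X(2))
  have "\<tau> = 1 \<longrightarrow> w = 0"
    using fin unfolding f tau_divergence_fbar[OF X(1)] by (auto simp: delta_infty_def split: if_splits)
  with f X(1) show ?r by blast
next
  assume ?r
  then obtain X w where X: "pos_def_matrix X" "\<tau> = 1 \<longrightarrow> w = 0"
    and f: "f = gaussian_density (stack m1 m2 + L *v w) (L ** X ** transpose L)" by blast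
  have "pos_def_matrix (L ** X ** transpose L)"
    using X(1) invertible_transpose_eq_0[OF L_invertible] by (intro pos_def_matrix_congruence)
  moreover have "tau_divergence \<tau> L f fbar < \<infinity>"
    unfolding f tau_divergence_fbar[OF X(1)] using X(2) tau by (auto simp: delta_infty_def)
  ultimately show "f \<in> ambiguity_set \<tau> L fbar" unfolding ambiguity_set_def using f by blast
qed

lemma f_lf_eq: "f_lf = gaussian_density (stack m1 m2 + L *v 0) (L ** X0 ** transpose L)"
  by (simp add: f_lf_def X0_covariance)

lemma f_lf_in_ambiguity_set: "f_lf \<in> ambiguity_set \<tau> L fbar"
  unfolding ambiguity_set_iff f_lf_eq using X0_pos_def by blast

text \<open>The error of \<open>g_opt\<close> is \<open>M\<close> applied to the deviation from the
  nominal mean, hence has mean \<open>H *v w\<close> and covariance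
  \<open>H ** X ** transpose H\<close>. Mean and covariance thus contribute separately.\<close>

lemma risk_objective_g_opt:
  assumes X: "pos_def_matrix X" and w: "\<tau> = 1 \<longrightarrow> w = 0"
  shows "risk_objective \<tau> \<theta> L fbar g_opt (gaussian_density (stack m1 m2 + L *v w) (L ** X ** transpose L))
    = ereal (gain X + (if \<tau> < 1 then (norm (H *v w))\<^sup>2 - (norm w)\<^sup>2 / (\<theta> * (1 - \<tau>)) else 0))"
proof -
  let ?K = "L ** X ** transpose L" and ?m = "stack m1 m2 + L *v w"
  have K: "pos_def_matrix ?K"
    using X invertible_transpose_eq_0[OF L_invertible] by (intro pos_def_matrix_congruence)
  have err: "upper z - g_opt (lower z) = M *v z + - (M *v stack m1 m2)" for z
    by (simp add: M_mult g_opt_def matrix_vector_mult_diff_distrib)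
  have "density_expectation (gaussian_density ?m ?K) (\<lambda>z. (norm (upper z - g_opt (lower z)))\<^sup>2)
      = trace (M ** ?K ** transpose M) + (norm (M *v ?m + - (M *v stack m1 m2)))\<^sup>2"
    unfolding density_expectation_def err
    using gaussian_second_moment[OF K, of M "- (M *v stack m1 m2)" ?m] by (simp add: has_bochner_integral_iff)
  also have "M *v ?m + - (M *v stack m1 m2) = H *v w"
    by (simp add: H_def matrix_vector_right_distrib matrix_vector_mul_assoc)
  also have "M ** ?K ** transpose M = H ** X ** transpose H"
    by (simp add: H_def matrix_transpose_mul matrix_mul_assoc)
  finally have "density_expectation (gaussian_density ?m ?K) (\<lambda>z. (norm (upper z - g_opt (lower z)))\<^sup>2)
      = trace (H ** X ** transpose H) + (norm (H *v w))\<^sup>2" .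
  then show ?thesis
    unfolding risk_objective_def tau_divergence_fbar[OF X] using w tau
    by (auto simp: gain_def delta_infty_def add_divide_distrib mult.commute[of \<theta>])
qed

lemma risk_objective_g_opt_f_lf: "risk_objective \<tau> \<theta> L fbar g_opt f_lf = ereal (gain X0)"
  unfolding f_lf_eq by (subst risk_objective_g_opt[OF X0_pos_def]) auto

text \<open>Leaving \<open>X0\<close> strictly lowers \<open>gain\<close>, and shifting the mean
  strictly lowers the form \<open>q\<close>; a density other than \<open>f_lf\<close> does at least
  one of the two.\<close>

lemma risk_objective_g_opt_less:
  assumes "f \<in> ambiguity_set \<tau> L fbar" "f \<noteq> f_lf"
  shows "risk_objective \<tau> \<theta> L fbar g_opt f < risk_objective \<tau> \<theta> L fbar g_opt f_lf"
proof -
  obtain X w where X: "pos_def_matrix X" and w: "\<tau> = 1 \<longrightarrow> w = 0"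
    and f: "f = gaussian_density (stack m1 m2 + L *v w) (L ** X ** transpose L)"
    using assms(1) unfolding ambiguity_set_iff by blast
  define q where "q = (if \<tau> < 1 then (norm (H *v w))\<^sup>2 - (norm w)\<^sup>2 / (\<theta> * (1 - \<tau>)) else 0)"
  have q: "q < 0" if "w \<noteq> 0"
    using H_bound[OF _ that] that w tau theta by (auto simp: q_def field_simps)
  have q0: "q = 0" if "w = 0" using that by (simp add: q_def)
  have "X \<noteq> X0 \<or> w \<noteq> 0" using assms(2) f f_lf_eq by auto
  then have "gain X + q < gain X0"
    using gain_less[OF X] q q0 by (cases "w = 0"; cases "X = X0") force+
  then show ?thesis
    unfolding f risk_objective_g_opt[OF X w] q_def[symmetric] risk_objective_g_opt_f_lf by simp
qed

lemma least_favorable_iff: "least_favorable \<tau> \<theta> L fbar g_opt f \<longleftrightarrow> f = f_lf"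
proof -
  have "risk_objective \<tau> \<theta> L fbar g_opt f \<le> risk_objective \<tau> \<theta> L fbar g_opt f_lf"
    if "f \<in> ambiguity_set \<tau> L fbar" for f
    using risk_objective_g_opt_less[OF that] by (cases "f = f_lf") auto
  then show ?thesis
    unfolding least_favorable_def is_arg_max_def
    using f_lf_in_ambiguity_set risk_objective_g_opt_less by (metis not_le)
qed

lemma SUP_risk_objective_g_opt:
  "(SUP f \<in> ambiguity_set \<tau> L fbar. risk_objective \<tau> \<theta> L fbar g_opt f) = risk_objective \<tau> \<theta> L fbar g_opt f_lf"
proof (rule antisym)
  show "(SUP f \<in> ambiguity_set \<tau> L fbar. risk_objective \<tau> \<theta> L fbar g_opt f)
      \<le> risk_objective \<tau> \<theta> L fbar g_opt f_lf"
  proof (rule SUP_least)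
    fix f assume "f \<in> ambiguity_set \<tau> L fbar"
    then show "risk_objective \<tau> \<theta> L fbar g_opt f \<le> risk_objective \<tau> \<theta> L fbar g_opt f_lf"
      using risk_objective_g_opt_less[of f] by (cases "f = f_lf") auto
  qed
qed (intro SUP_upper f_lf_in_ambiguity_set)

lemma g_opt_in_estimator_set: "g_opt \<in> estimator_set \<tau> L fbar"
proof -
  have "integrable lborel (\<lambda>z. (norm (g_opt (lower z)))\<^sup>2 * f z)" if f: "f \<in> ambiguity_set \<tau> L fbar" for f
  proof -
    obtain m K where K: "pos_def_matrix K" "f = gaussian_density m K"
      using f by (auto simp: ambiguity_set_def)
    let ?l = "\<lambda>z :: real^('n + 'p). G *v lower z"
    have "linear ?l" by (auto intro!: linearI simp: upper_lower_arith algebra_simps matrix_vector_mult_scaleR)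
    then have "g_opt (lower z) = matrix ?l *v z + (m1 - G *v m2)" for z
      by (simp add: matrix_works g_opt_def matrix_vector_mult_diff_distrib)
    then show ?thesis
      using gaussian_second_moment[OF K(1), of "matrix ?l" "m1 - G *v m2" m]
      by (simp add: K(2) has_bochner_integral_iff)
  qed
  moreover have "g_opt \<in> borel_measurable borel" unfolding g_opt_def[abs_def] by measurable
  ultimately show ?thesis by (auto simp: estimator_set_def)
qed

text \<open>The other half of the saddle point: \<open>f_lf\<close> keeps \<open>G\<close> and the
  means, so \<open>g_opt\<close> is its regression too. Its divergence is finite and common to both
  sides.\<close>

lemma risk_objective_f_lf:
  assumes "g \<in> estimator_set \<tau> L fbar"
  shows "risk_objective \<tau> \<theta> L fbar g f_lf = risk_objective \<tau> \<theta> L fbar g_opt f_lf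
    + ereal (density_expectation f_lf (\<lambda>z. (norm (g_opt (lower z) - g (lower z)))\<^sup>2))"
    and "integrable lborel (\<lambda>z. (norm (g_opt (lower z) - g (lower z)))\<^sup>2 * f_lf z)"
proof -
  have g: "g \<in> borel_measurable borel" "integrable lborel (\<lambda>z. (norm (g (lower z)))\<^sup>2 * f_lf z)"
    using assms f_lf_in_ambiguity_set by (auto simp: estimator_set_def)
  note split = estimation_error_split[OF V_lf_pos_def R g(1), of m1 m2 G, folded f_lf_def g_opt_def, OF g(2)]
  show "integrable lborel (\<lambda>z. (norm (g_opt (lower z) - g (lower z)))\<^sup>2 * f_lf z)" by (rule split(1))
  have "tau_divergence \<tau> L f_lf fbar = ereal (trace (matrix_fun (tau_entropy \<tau>) X0))"
    unfolding f_lf_eq tau_divergence_fbar[OF X0_pos_def] by (simp add: delta_infty_def)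
  then show "risk_objective \<tau> \<theta> L fbar g f_lf = risk_objective \<tau> \<theta> L fbar g_opt f_lf
    + ereal (density_expectation f_lf (\<lambda>z. (norm (g_opt (lower z) - g (lower z)))\<^sup>2))"
    by (simp add: risk_objective_def split(2))
qed

lemma f_lf_pos: "0 < f_lf z"
  unfolding f_lf_def by (intro gaussian_density_pos pos_def_schur_block V_lf_pos_def R)

lemma risk_objective_f_lf_ge:
  assumes "g \<in> estimator_set \<tau> L fbar"
  shows "risk_objective \<tau> \<theta> L fbar g_opt f_lf \<le> risk_objective \<tau> \<theta> L fbar g f_lf"
proof -
  have "0 \<le> density_expectation f_lf (\<lambda>z. (norm (g_opt (lower z) - g (lower z)))\<^sup>2)"
    unfolding density_expectation_def using f_lf_pos by (intro integral_nonneg_AE) (simp add: less_imp_le)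
  then show ?thesis unfolding risk_objective_f_lf(1)[OF assms] by (simp add: add_increasing2)
qed

text \<open>Against any \<open>g\<close> the adversary may answer with \<open>f_lf\<close>, and this
  answer alone already yields at least the saddle value.\<close>

lemma g_opt_optimal: "optimal_estimator \<tau> \<theta> L fbar g_opt"
  unfolding optimal_estimator_def is_arg_min_def SUP_risk_objective_g_opt
proof (intro conjI notI g_opt_in_estimator_set)
  assume "\<exists>g. g \<in> estimator_set \<tau> L fbar
    \<and> (SUP f \<in> ambiguity_set \<tau> L fbar. risk_objective \<tau> \<theta> L fbar g f) < risk_objective \<tau> \<theta> L fbar g_opt f_lf"
  then obtain g where g: "g \<in> estimator_set \<tau> L fbar"
    "(SUP f \<in> ambiguity_set \<tau> L fbar. risk_objective \<tau> \<theta> L fbar g f) < risk_objective \<tau> \<theta> L fbar g_opt f_lf"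
    by blast
  have "risk_objective \<tau> \<theta> L fbar g f_lf \<le> (SUP f \<in> ambiguity_set \<tau> L fbar. risk_objective \<tau> \<theta> L fbar g f)"
    by (intro SUP_upper f_lf_in_ambiguity_set)
  then show False using g(2) risk_objective_f_lf_ge[OF g(1)] by simp
qed

text \<open>An optimal \<open>g\<close> has at most the saddle value at \<open>f_lf\<close>, so its
  mean squared distance from \<open>g_opt\<close> under \<open>f_lf\<close> vanishes. Since
  \<open>f_lf\<close> is positive everywhere, this is equality almost everywhere for Lebesgue
  measure.\<close>

lemma optimal_estimator_unique:
  assumes "optimal_estimator \<tau> \<theta> L fbar g"
  shows "AE y in lborel. g y = g_opt y"
proof -
  have g: "g \<in> estimator_set \<tau> L fbar"
    and le: "\<not> risk_objective \<tau> \<theta> L fbar g_opt f_lf < (SUP f \<in> ambiguity_set \<tau> L fbar. risk_objective \<tau> \<theta> L fbar g f)"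
    using assms g_opt_in_estimator_set
    unfolding optimal_estimator_def is_arg_min_def SUP_risk_objective_g_opt[symmetric] by auto
  have [measurable]: "g \<in> borel_measurable borel" using g by (simp add: estimator_set_def)
  have [measurable]: "g_opt \<in> borel_measurable borel" using g_opt_in_estimator_set by (simp add: estimator_set_def)
  let ?h = "\<lambda>z. (norm (g_opt (lower z) - g (lower z)))\<^sup>2 * f_lf z"
  have nn: "0 \<le> ?h z" for z using f_lf_pos by (simp add: less_imp_le)
  have "risk_objective \<tau> \<theta> L fbar g f_lf \<le> (SUP f \<in> ambiguity_set \<tau> L fbar. risk_objective \<tau> \<theta> L fbar g f)"
    by (intro SUP_upper f_lf_in_ambiguity_set)
  with le have "risk_objective \<tau> \<theta> L fbar g f_lf \<le> risk_objective \<tau> \<theta> L fbar g_opt f_lf"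
    by simp
  then have "(\<integral>z. ?h z \<partial>lborel) \<le> 0"
    unfolding risk_objective_f_lf(1)[OF g] risk_objective_g_opt_f_lf density_expectation_def by simp
  then have "(\<integral>z. ?h z \<partial>lborel) = 0"
    using nn by (intro antisym integral_nonneg_AE) auto
  then have "AE z in lborel. ?h z = 0"
    using risk_objective_f_lf(2)[OF g] nn by (subst (asm) integral_nonneg_eq_0_iff_AE) auto
  then have "AE z :: real^('n + 'p) in lborel. g (lower z) = g_opt (lower z)"
    using f_lf_pos by (auto simp: less_imp_neq[symmetric])
  then show ?thesis by (rule AE_lborel_lower[rotated]) measurable
qed

text \<open>The Gram identity again, with \<open>LP\<close> in the place of \<open>H\<close>: both
  have \<open>P\<close> as their outer Gram matrix, so both lead to the same expression in
  \<open>P\<close>.\<close>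

lemma V_lf_factor:
  assumes "P = LP ** transpose LP"
  shows "V_lf = LP ** matrix_fun (tilt \<tau> \<theta>) (transpose LP ** LP) ** transpose LP"
  unfolding V_lf_def unfolding assms
  by (subst matrix_fun_gram) (simp_all add: matrix_add_ldistrib matrix_add_rdistrib matrix_mul_assoc)

end

section \<open>From the state-space model to the Schur form\<close>

lemma stack_matrix_mult:
  fixes X :: "real^'k^'n::finite" and Y :: "real^'k^'p::finite"
  shows "stack X Y ** W = stack (X ** W) (Y ** W)"
  by (simp add: vec_eq_Plus_iff) (simp add: vec_eq_iff matrix_matrix_mult_def)

lemma matrix_mult_transpose_stack_nth:
  fixes Z :: "real^'k^'n::finite" and W :: "real^'k^'p::finite"
  shows "(X ** transpose (stack Z W)) $ i $ Inl j = (X ** transpose Z) $ i $ j"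
    "(X ** transpose (stack Z W)) $ i $ Inr j' = (X ** transpose W) $ i $ j'"
  by (simp_all add: matrix_matrix_mult_def transpose_def)

lemma transpose_stack_mult:
  fixes A :: "real^'k^'n::finite" and C :: "real^'k^'p::finite"
  shows "transpose (stack A C) *v stack a b = transpose A *v a + transpose C *v b"
  by (simp add: vec_eq_iff matrix_vector_mult_def transpose_def sum_UNIV_Plus)

theorem mainTheorem2:
  fixes \<tau> \<theta> :: real
    and A :: "real^'n::finite^'n" and B :: "real^('n + 'p::finite)^'n"
    and C :: "real^'n^'p" and D :: "real^('n + 'p)^'p"
    and \<Gamma> :: "real^('n + 'p)^('n + 'p)"
    and xh :: "real^'n" and V :: "real^'n^'n"
    and Kz Lz :: "real^('n + 'p)^('n + 'p)"
    and fbar :: "real^('n + 'p) \<Rightarrow> real"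
    and G :: "real^'p^'n" and P LP V' :: "real^'n^'n"
    and g_opt :: "real^'p \<Rightarrow> real^'n"
  assumes tau: "0 \<le> \<tau>" "\<tau> \<le> 1" and theta: "0 < \<theta>"
    and Gamma: "\<Gamma> = stack B D" "invertible \<Gamma>"
    and V: "pos_def_matrix V"
    and Kz: "Kz = stack A C ** V ** transpose (stack A C) + \<Gamma> ** transpose \<Gamma>"
    and fbar: "fbar = gaussian_density (stack A C *v xh) Kz"
    and Lz: "Kz = Lz ** transpose Lz"
    and G: "G = (A ** V ** transpose C + B ** transpose D)
                ** matrix_inv (C ** V ** transpose C + D ** transpose D)"
    and P: "P = A ** V ** transpose A
                - G ** (C ** V ** transpose C + D ** transpose D) ** transpose G
                + B ** transpose B"
    and LP: "P = LP ** transpose LP"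
    and P_bound: "\<tau> < 1 \<Longrightarrow> matrix_less P (inverse (\<theta> * (1 - \<tau>)) *\<^sub>R mat 1)"
    and g_opt: "g_opt = (\<lambda>y. A *v xh + G *v (y - C *v xh))"
    and V': "V' = (if \<tau> < 1
          then LP ** matrix_fun (\<lambda>x. x powr (1 / (\<tau> - 1)))
                       (mat 1 - (\<theta> * (1 - \<tau>)) *\<^sub>R (transpose LP ** LP)) ** transpose LP
          else LP ** matrix_fun exp (\<theta> *\<^sub>R (transpose LP ** LP)) ** transpose LP)"
  shows "optimal_estimator \<tau> \<theta> Lz fbar g_opt
    \<and> (\<forall>g. optimal_estimator \<tau> \<theta> Lz fbar g \<longrightarrow> (AE y in lborel. g y = g_opt y))
    \<and> (\<exists>fo. (\<forall>f. least_favorable \<tau> \<theta> Lz fbar g_opt f \<longleftrightarrow> f = fo)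
          \<and> (\<exists>m K. pos_def_matrix K \<and> fo = gaussian_density m K)
          \<and> density_mean fo = density_mean fbar
          \<and> (\<forall>i j. density_cov fo $ Inl i $ Inr j = Kz $ Inl i $ Inr j)
          \<and> (\<forall>j i. density_cov fo $ Inr j $ Inl i = Kz $ Inr j $ Inl i)
          \<and> (\<forall>j j'. density_cov fo $ Inr j $ Inr j' = Kz $ Inr j $ Inr j')
          \<and> (\<forall>y. density_cov (cond_density fo y) = V'))"
proof -
  define R where "R = C ** V ** transpose C + D ** transpose D"
  \<comment> \<open>For \<open>z \<noteq> 0\<close> the second square is strictly positive because
    \<open>\<Gamma>\<close> is invertible. Evaluated at \<open>stack 0 x\<close>, the same formula
    handles \<open>R\<close>.\<close>
  have quad: "z \<bullet> (Kz *v z) = (transpose (stack A C) *v z) \<bullet> (V *v (transpose (stack A C) *v z))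
      + (transpose \<Gamma> *v z) \<bullet> (transpose \<Gamma> *v z)" for z
    unfolding Kz
    by (simp add: matrix_vector_mult_add_rdistrib inner_add_right inner_matrix_transpose[of z \<Gamma>]
        inner_matrix_transpose[of z "stack A C"] flip: matrix_vector_mul_assoc)
  have V_nonneg: "0 \<le> x \<bullet> (V *v x)" for x
    using V unfolding pos_def_matrix_def by (cases "x = 0") (auto simp: less_imp_le)
  have V_sym: "transpose V = V" using V by (rule pos_def_matrix_sym)
  have Kz_pos: "pos_def_matrix Kz"
    unfolding pos_def_matrix_def
  proof (intro conjI allI impI)
    show "transpose Kz = Kz"
      by (simp add: Kz transpose_add matrix_transpose_mul V_sym matrix_mul_assoc)
    fix z :: "real^('n + 'p)" assume "z \<noteq> 0"
    then have "transpose \<Gamma> *v z \<noteq> 0" using invertible_transpose_eq_0[OF Gamma(2)] by blast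
    then show "0 < z \<bullet> (Kz *v z)"
      unfolding quad by (intro add_nonneg_pos V_nonneg) simp
  qed
  have R_sym: "transpose R = R"
    by (simp add: R_def transpose_add matrix_transpose_mul V_sym matrix_mul_assoc)
  have R_pos: "pos_def_matrix R"
    unfolding pos_def_matrix_def
  proof (intro conjI allI impI R_sym)
    fix x :: "real^'p" assume "x \<noteq> 0"
    then have "0 < stack 0 x \<bullet> (Kz *v stack 0 x)"
      using Kz_pos by (simp add: pos_def_matrix_def stack_arith)
    then show "0 < x \<bullet> (R *v x)"
      unfolding quad Gamma(1) transpose_stack_mult
      by (simp add: R_def matrix_vector_mult_add_rdistrib inner_add_right inner_matrix_transpose[of x C]
          inner_matrix_transpose[of x D] flip: matrix_vector_mul_assoc)
  qed
  have GR: "G ** R = A ** V ** transpose C + B ** transpose D"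
    using matrix_inv_left[OF pos_def_matrix_invertible[OF R_pos]] unfolding G R_def[symmetric]
    by (metis matrix_mul_assoc matrix_mul_rid)
  have RG: "R ** transpose G = C ** V ** transpose A + D ** transpose B"
  proof -
    have "R ** transpose G = transpose (G ** R)" by (simp add: matrix_transpose_mul R_sym)
    then show ?thesis
      by (simp add: GR transpose_add matrix_transpose_mul V_sym matrix_mul_assoc)
  qed
  have PG: "P + G ** R ** transpose G = A ** V ** transpose A + B ** transpose B"
    by (simp add: P R_def[symmetric])
  \<comment> \<open>\<open>G\<close> and \<open>P\<close> are the regression matrix and the Schur
    complement of the joint covariance: \<open>G ** R\<close> is its cross block, and
    \<open>PG\<close> recovers its upper block.\<close>
  have Kz_block: "Kz = schur_block P G R"
    unfolding vec_eq_iff[of Kz] vec_eq_iff[of "Kz $ _"] split_sum_all schur_block_nth PG unfolding GR RG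
    by (simp add: Kz Gamma(1) stack_matrix_mult matrix_mult_transpose_stack_nth R_def)
  have P_sym: "transpose P = P"
    by (simp add: P R_def[symmetric] transpose_add transpose_diff matrix_transpose_mul V_sym R_sym matrix_mul_assoc)
  have P_pos: "pos_def_matrix P"
    using pos_def_schur_blockD(1)[OF _ P_sym] Kz_pos unfolding Kz_block by blast
  interpret rp: risk_problem \<tau> \<theta> P G R Lz "A *v xh" "C *v xh"
    by unfold_locales (use tau theta P_pos R_pos Lz Kz_block P_bound in auto)
  have fbar': "fbar = rp.fbar"
    by (simp add: fbar rp.fbar_def stack_matrix_vector_mult Kz_block)
  have g_opt': "g_opt = rp.g_opt"
    by (simp add: g_opt rp.g_opt_def fun_eq_iff)
  \<comment> \<open>The affine maps have coefficients 1 and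
    \<open>- (\<theta> * (1 - \<tau>))\<close> for the power, 0 and \<open>\<theta>\<close> for the
    exponential; composed with them, both scalar functions are
    \<open>tilt \<tau> \<theta>\<close>.\<close>
  have V'': "V' = rp.V_lf"
  proof -
    have S: "transpose (transpose LP ** LP) = transpose LP ** LP" by (simp add: matrix_transpose_mul)
    show ?thesis
      using matrix_fun_affine[OF S, of "\<lambda>x. x powr (1 / (\<tau> - 1))" 1 "- (\<theta> * (1 - \<tau>))"]
        matrix_fun_affine[OF S, of exp 0 \<theta>]
      unfolding V' rp.V_lf_factor[OF LP] by (simp add: tilt_def[abs_def])
  qed
  have K0: "pos_def_matrix (schur_block rp.V_lf G R)"
    by (rule pos_def_schur_block[OF rp.V_lf_pos_def R_pos])
  show ?thesis
    unfolding fbar' g_opt'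
  proof (intro conjI allI impI exI[of _ rp.f_lf])
    show "optimal_estimator \<tau> \<theta> Lz rp.fbar rp.g_opt" by (rule rp.g_opt_optimal)
    show "AE y in lborel. g y = rp.g_opt y" if "optimal_estimator \<tau> \<theta> Lz rp.fbar g" for g
      using that by (rule rp.optimal_estimator_unique)
    show "least_favorable \<tau> \<theta> Lz rp.fbar rp.g_opt f \<longleftrightarrow> f = rp.f_lf" for f
      by (rule rp.least_favorable_iff)
    show "\<exists>m K. pos_def_matrix K \<and> rp.f_lf = gaussian_density m K"
      using K0 rp.f_lf_def by blast
    show "density_mean rp.f_lf = density_mean rp.fbar"
      using K0 rp.K_pos_def by (simp add: rp.f_lf_def rp.fbar_def)
    show "density_cov rp.f_lf $ Inl i $ Inr j = Kz $ Inl i $ Inr j"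
      "density_cov rp.f_lf $ Inr j $ Inl i = Kz $ Inr j $ Inl i"
      "density_cov rp.f_lf $ Inr j $ Inr j' = Kz $ Inr j $ Inr j'" for i j j'
      using K0 by (simp_all add: rp.f_lf_def Kz_block)
    show "density_cov (cond_density rp.f_lf y) = V'" for y
      using rp.V_lf_pos_def R_pos by (simp add: rp.f_lf_def cond_density_schur_block V'')
  qed
qed

end
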